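(* The contact exponent of a reduced curve is an equisingularity invariant: if $C$ and $D$ are equisingular reduced plane algebroid curves over $K$, then $d(C)=d(D)$.
   Context: $K$ is an algebraically closed field of arbitrary characteristic. An algebroid curve $C:\{f=0\}$ is the ideal of $K[[x,y]]$ generated by a nonzero power series $f$ without constant term; its multiplicity is $m(C)=\mathrm{ord}\, f$. $C$ is reduced if $f$ has no multiple factors; $C$ is a branch if $f$ is irreducible; a branch is smooth if its multiplicity is $1$. The branches of a reduced curve $C:\{f=0\}$ are the curves defined by the irreducible factors of $f$. For $C:\{f=0\}$, $D:\{g=0\}$ put $(C,D)_0=\dim_K K[[x,y]]/(f,g)$ (intersection number, possibly $+\infty$). For branches $C,D$ put $d(C,D)=\frac{(C,D)_0}{m(C)m(D)}$ (so $d(C,C)=+\infty$); for reduced curves $C,D$ with branches $C_i,D_j$ put $d(C,D)=\inf_{i,j}\{d(C_i,D_j)\}$. The contact exponent of a reduced curve $C$ is $d(C):=\sup\{d(C,W): W \text{ a smooth branch}\}$. The semigroup of a branch $C:\{f=0\}$ is $\Gamma(C)=\{\dim_K K[[x,y]]/(f,g): g\in K[[x,y]],\ g\not\equiv 0 \pmod f\}$. Two branches are equisingular if their semigroups are equal. Two reduced curves $C$, $D$ are equisingular if they have the same number $r$ of branches and the branches can be numbered $C_1,\dots,C_r$ and $D_1,\dots,D_r$ so that $\Gamma(C_i)=\Gamma(D_i)$ for all $i$ and $(C_i,C_j)_0=(D_i,D_j)_0$ for all $i,j$. An equisingularity invariant is a function $I$ on the set of reduced curves such that $I(C)=I(D)$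 whenever $C,D$ are equisingular. *)

theory Defs
  imports
    "HOL-Computational_Algebra.Computational_Algebra"
    "HOL-Library.Extended_Real"
begin

text \<open>
  The ring \<open>K[[x,y]]\<close> is rendered as \<open>K[[x]][[y]]\<close>, i.e. as the type \<open>'a fps fps\<close>;
  \<open>f $ i $ j\<close> is the coefficient of the monomial \<open>x^j y^i\<close>.
\<close>

type_synonym 'a fps2 = "'a fps fps"

definition ideal_gen :: "'a::comm_ring_1 fps2 set \<Rightarrow> 'a fps2 set" where
  "ideal_gen S = module.span (*) S"

definition scale_fps2 :: "'a::comm_ring_1 \<Rightarrow> 'a fps2 \<Rightarrow> 'a fps2" where
  "scale_fps2 c f = fps_const (fps_const c) * f"

text \<open>
  The image of \<open>S\<close> in \<open>K[[x,y]]/I\<close> is linearly independent over \<open>K\<close> and \<open>S\<close> maps injectively.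
\<close>

definition independent_mod :: "'a::field fps2 set \<Rightarrow> 'a fps2 set \<Rightarrow> bool" where
  "independent_mod I S \<longleftrightarrow>
     (\<forall>c. (\<Sum>s\<in>S. scale_fps2 (c s) s) \<in> I \<longrightarrow> (\<forall>s\<in>S. c s = 0))"

text \<open>\<open>dim\<^sub>K K[[x,y]]/I\<close>, with value \<open>\<infinity>\<close> for every infinite dimension.\<close>

definition quotient_dim :: "'a::field fps2 set \<Rightarrow> enat" where
  "quotient_dim I = (SUP S\<in>{S. finite S \<and> independent_mod I S}. enat (card S))"

definition fps2_ord :: "'a::field fps2 \<Rightarrow> nat" where
  "fps2_ord f = (LEAST n. \<exists>i j. i + j = n \<and> f $ i $ j \<noteq> 0)"

text \<open>A curve is an ideal, so its equation is determined only up to a unit.\<close>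

definition algebroid_curve :: "'a::field fps2 set \<Rightarrow> bool" where
  "algebroid_curve C \<longleftrightarrow> (\<exists>f. f \<noteq> 0 \<and> f $ 0 $ 0 = 0 \<and> C = ideal_gen {f})"

text \<open>
  By \<open>multiplicity_ideal_gen\<close> below, the number does not depend on the choice of the equation.
\<close>

definition multiplicity :: "'a::field fps2 set \<Rightarrow> nat" where
  "multiplicity C = (THE n. \<exists>f. C = ideal_gen {f} \<and> n = fps2_ord f)"

definition reduced_curve :: "'a::field fps2 set \<Rightarrow> bool" where
  "reduced_curve C \<longleftrightarrow> algebroid_curve C \<and> (\<exists>f. C = ideal_gen {f} \<and> squarefree f)"

definition branch :: "'a::field fps2 set \<Rightarrow> bool" where
  "branch C \<longleftrightarrow> algebroid_curve C \<and> (\<exists>f. C = ideal_gen {f} \<and> irreducible f)"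

definition smooth_branch :: "'a::field fps2 set \<Rightarrow> bool" where
  "smooth_branch C \<longleftrightarrow> branch C \<and> multiplicity C = 1"

definition branches :: "'a::field fps2 set \<Rightarrow> 'a fps2 set set" where
  "branches C = {ideal_gen {p} | f p. C = ideal_gen {f} \<and> irreducible p \<and> p dvd f}"

text \<open>
  If \<open>C\<close> and \<open>D\<close> are generated by \<open>f\<close> and \<open>g\<close>, then \<open>C \<union> D\<close> generates the ideal \<open>(f, g)\<close>;
  see \<open>intersection_number_ideal_gen\<close> below.
\<close>

definition intersection_number :: "'a::field fps2 set \<Rightarrow> 'a fps2 set \<Rightarrow> enat" where
  "intersection_number C D = quotient_dim (ideal_gen (C \<union> D))"

definition branch_contact :: "'a::field fps2 set \<Rightarrow> 'a fps2 set \<Rightarrow> ereal" where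
  "branch_contact C D =
     ereal_of_enat (intersection_number C D) / ereal (real (multiplicity C) * real (multiplicity D))"

definition contact :: "'a::field fps2 set \<Rightarrow> 'a fps2 set \<Rightarrow> ereal" where
  "contact C D = (INF (B, B')\<in>branches C \<times> branches D. branch_contact B B')"

definition contact_exponent :: "'a::field fps2 set \<Rightarrow> ereal" where
  "contact_exponent C = (SUP W\<in>{W. smooth_branch W}. contact C W)"

definition branch_semigroup :: "'a::field fps2 set \<Rightarrow> enat set" where
  "branch_semigroup C = {quotient_dim (ideal_gen {f, g}) | f g. C = ideal_gen {f} \<and> \<not> f dvd g}"

definition equisingular :: "'a::field fps2 set \<Rightarrow> 'a fps2 set \<Rightarrow> bool" where
  "equisingular C D \<longleftrightarrow>
     (\<exists>(r::nat) Cs Ds.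
        bij_betw Cs {1..r} (branches C) \<and> bij_betw Ds {1..r} (branches D) \<and>
        (\<forall>i\<in>{1..r}. branch_semigroup (Cs i) = branch_semigroup (Ds i)) \<and>
        (\<forall>i\<in>{1..r}. \<forall>j\<in>{1..r}.
           intersection_number (Cs i) (Cs j) = intersection_number (Ds i) (Ds j)))"

definition equisingularity_invariant :: "('a::field fps2 set \<Rightarrow> 'b) \<Rightarrow> bool" where
  "equisingularity_invariant I \<longleftrightarrow>
     (\<forall>C D. reduced_curve C \<longrightarrow> reduced_curve D \<longrightarrow> equisingular C D \<longrightarrow> I C = I D)"


subsection \<open>Consistency of the definitions\<close>

lemma module_fps2: "module ((*) :: 'a::comm_ring_1 fps2 \<Rightarrow> 'a fps2 \<Rightarrow> 'a fps2)"
  by unfold_locales (simp_all add: distrib_left distrib_right mult.assoc)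

lemma vector_space_fps2: "vector_space (scale_fps2 :: 'a::field \<Rightarrow> 'a fps2 \<Rightarrow> 'a fps2)"
proof unfold_locales
  fix a b :: 'a and f g :: "'a fps2"
  show "scale_fps2 a (f + g) = scale_fps2 a f + scale_fps2 a g"
    by (simp add: scale_fps2_def distrib_left)
  have "fps_const (fps_const (a + b)) = fps_const (fps_const a) + fps_const (fps_const b)"
    by simp
  thus "scale_fps2 (a + b) f = scale_fps2 a f + scale_fps2 b f"
    by (simp only: scale_fps2_def distrib_right)
  have "fps_const (fps_const (a * b)) = fps_const (fps_const a) * fps_const (fps_const b)"
    by simp
  thus "scale_fps2 a (scale_fps2 b f) = scale_fps2 (a * b) f"
    by (simp only: scale_fps2_def mult.assoc)
  show "scale_fps2 1 f = f"
    by (simp add: scale_fps2_def)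
qed

lemma ideal_gen_singleton: "ideal_gen {f} = {h. f dvd h}"
proof -
  interpret module "(*) :: 'a fps2 \<Rightarrow> 'a fps2 \<Rightarrow> 'a fps2"
    by (rule module_fps2)
  show ?thesis
    by (auto simp: ideal_gen_def span_singleton dvd_def mult.commute)
qed

lemma fps2_ord_le_of_dvd:
  assumes "f dvd g" "g \<noteq> (0 :: 'a::field fps2)"
  shows "fps2_ord f \<le> fps2_ord g"
proof -
  obtain h where h: "g = f * h"
    using assms by (elim dvdE)
  have "\<exists>i j. g $ i $ j \<noteq> 0"
    using assms(2) by (auto simp: fps_eq_iff)
  hence "\<exists>n i j. i + j = n \<and> g $ i $ j \<noteq> 0"
    by blast
  hence "\<exists>i j. i + j = fps2_ord g \<and> g $ i $ j \<noteq> 0"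
    unfolding fps2_ord_def by (rule LeastI_ex)
  then obtain i j where ij: "i + j = fps2_ord g" "g $ i $ j \<noteq> 0"
    by blast
  have "g $ i $ j = (\<Sum>k=0..i. \<Sum>l=0..j. f $ k $ l * h $ (i - k) $ (j - l))"
    by (simp add: h fps_mult_nth fps_sum_nth)
  with ij(2) obtain k l where kl: "k \<le> i" "l \<le> j" "f $ k $ l \<noteq> 0"
    by (metis (no_types, lifting) atLeastAtMost_iff mult_zero_left sum.neutral)
  have "fps2_ord f \<le> k + l"
    unfolding fps2_ord_def by (rule Least_le) (use kl in blast)
  with kl ij(1) show ?thesis
    by linarith
qed

lemma multiplicity_ideal_gen:
  assumes "f \<noteq> 0"
  shows "multiplicity (ideal_gen {f}) = fps2_ord f"
  unfolding multiplicity_def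
proof (rule the_equality)
  show "\<exists>f'. ideal_gen {f} = ideal_gen {f'} \<and> fps2_ord f = fps2_ord f'"
    by blast
next
  fix n assume "\<exists>f'. ideal_gen {f} = ideal_gen {f'} \<and> n = fps2_ord f'"
  then obtain f' where f': "ideal_gen {f} = ideal_gen {f'}" "n = fps2_ord f'"
    by blast
  have "f \<in> ideal_gen {f}" "f' \<in> ideal_gen {f'}"
    by (simp_all add: ideal_gen_singleton)
  hence "f \<in> ideal_gen {f'}" "f' \<in> ideal_gen {f}"
    by (simp_all only: f'(1))
  hence dvd: "f' dvd f" "f dvd f'"
    by (simp_all add: ideal_gen_singleton)
  with assms have "f' \<noteq> 0"
    by auto
  show "n = fps2_ord f"
    unfolding f'(2)
    by (rule antisym[OF fps2_ord_le_of_dvd[OF dvd(1) assms]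
                        fps2_ord_le_of_dvd[OF dvd(2) \<open>f' \<noteq> 0\<close>]])
qed

lemma intersection_number_ideal_gen:
  "intersection_number (ideal_gen {f}) (ideal_gen {g}) = quotient_dim (ideal_gen {f, g})"
proof -
  interpret module "(*) :: 'a fps2 \<Rightarrow> 'a fps2 \<Rightarrow> 'a fps2"
    by (rule module_fps2)
  have "span (span {f} \<union> span {g}) = span ({f} \<union> {g})"
    by (simp only: span_Un span_span)
  thus ?thesis
    by (simp add: intersection_number_def ideal_gen_def insert_commute)
qed

lemma quotient_dim_eq_card_basis:
  fixes B :: "'a::field fps2 set"
  assumes "finite B" "independent_mod (ideal_gen J) B"
    and spans: "\<And>f. \<exists>c. f - (\<Sum>b\<in>B. scale_fps2 (c b) b) \<in> ideal_gen J"
  shows "quotient_dim (ideal_gen J) = enat (card B)"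
proof -
  interpret M: module "(*) :: 'a fps2 \<Rightarrow> 'a fps2 \<Rightarrow> 'a fps2"
    by (rule module_fps2)
  interpret V: vector_space "scale_fps2 :: 'a \<Rightarrow> 'a fps2 \<Rightarrow> 'a fps2"
    by (rule vector_space_fps2)
  define I where "I = ideal_gen J"
  have sub: "M.subspace I"
    by (simp add: I_def ideal_gen_def M.subspace_span)
  have scaleI: "scale_fps2 a h \<in> I" if "h \<in> I" for a h
    using M.subspace_scale[OF sub that] by (simp add: scale_fps2_def)
  have "card S \<le> card B" if S: "finite S" "independent_mod I S" for S
  proof -
    from spans obtain c where
      c: "\<And>f. f - (\<Sum>b\<in>B. scale_fps2 (c f b) b) \<in> I"
      unfolding I_def by metis
    define t where "t f = (\<Sum>b\<in>B. scale_fps2 (c f b) b)" for f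
    have comb: "\<forall>s\<in>S. a s = 0" if "(\<Sum>s\<in>S. scale_fps2 (a s) (t s)) = 0" for a
    proof -
      have "(\<Sum>s\<in>S. scale_fps2 (a s) s) = (\<Sum>s\<in>S. scale_fps2 (a s) (s - t s))"
        using that by (simp add: V.scale_right_diff_distrib sum_subtractf)
      also have "\<dots> \<in> I"
        using c by (intro M.subspace_sum[OF sub] scaleI) (simp add: t_def)
      finally show ?thesis
        using S(2) by (auto simp: independent_mod_def)
    qed
    have inj: "inj_on t S"
    proof (rule inj_onI, rule ccontr)
      fix s s' assume s: "s \<in> S" "s' \<in> S" "t s = t s'" "s \<noteq> s'"
      define a where "a u = (if u = s then 1 else if u = s' then -1 else (0 :: 'a))" for u
      have "(\<Sum>u\<in>S. scale_fps2 (a u) (t u)) = (\<Sum>u\<in>{s, s'}. scale_fps2 (a u) (t u))"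
        using s S(1) by (intro sum.mono_neutral_right) (auto simp: a_def)
      also have "\<dots> = 0"
        using s by (simp add: a_def)
      finally have "a s = 0"
        using comb s(1) by blast
      thus False
        by (simp add: a_def)
    qed
    have "V.independent (t ` S)"
    proof (rule V.independent_if_scalars_zero)
      fix a x assume "(\<Sum>v\<in>t ` S. scale_fps2 (a v) v) = 0" and x: "x \<in> t ` S"
      hence "(\<Sum>s\<in>S. scale_fps2 (a (t s)) (t s)) = 0"
        by (simp add: sum.reindex[OF inj])
      with comb[of "\<lambda>s. a (t s)"] x show "a x = 0"
        by auto
    qed (use S in simp)
    moreover have "t ` S \<subseteq> V.span B"
      unfolding t_def by (intro image_subsetI V.span_sum V.span_scale V.span_base)
    ultimately have "card (t ` S) \<le> card B"
      using V.independent_span_bound[OF assms(1)] by blast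
    thus ?thesis
      by (simp add: card_image[OF inj])
  qed
  hence "quotient_dim I \<le> enat (card B)"
    unfolding quotient_dim_def by (intro SUP_least) auto
  moreover have "enat (card B) \<le> quotient_dim I"
    unfolding quotient_dim_def using assms(1,2) by (intro SUP_upper) (auto simp: I_def)
  ultimately show ?thesis
    by (simp add: I_def)
qed

end

theory Submission
  imports Defs
begin

text \<open>
Write \<open>(f, g)\<close> for the intersection number of \<open>f\<close> and \<open>g\<close> and \<open>m(f)\<close> for the order of \<open>f\<close>.
The theorem follows from a formula for the contact exponent in terms of a single branch \<open>C\<^sub>1\<close> of
the curve:

  \<open>d(C) = min (SUP W. d(C\<^sub>1, W)) (INF i. d(C\<^sub>1, C\<^sub>i))\<close>,

where \<open>W\<close> runs over the smooth branches (\<open>contact_exponent_eq_min\<close>). The second term is visibly an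
equisingularity invariant, provided that the multiplicities are; and the first one depends only on
the semigroup of \<open>C\<^sub>1\<close>.

The formula is a formal consequence of the strong triangle inequality for \<open>d\<close> in triangles
with a smooth vertex \<open>W\<close> (\<open>contact_ratio_triangle\<close>). A change of coordinates makes
\<open>W\<close> the axis \<open>y = 0\<close>. For an irreducible \<open>f\<close>, the number \<open>(f, y)\<close> is the exponent \<open>k\<close> of the first
monomial \<open>x\<^sup>k\<close> in \<open>f\<close>, and the Newton polygon of \<open>f\<close> lies on or above the line through \<open>(k, 0)\<close> and
\<open>(0, m(f))\<close>, since a vertex below that line is off the axes and forces \<open>f\<close> to factor
(\<open>reducible_if_mixed_initial\<close>, \<open>irreducible_newton_polygon\<close>). So \<open>k / m(f)\<close> is the slope of \<open>f\<close>, and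
the triangle inequality compares the intersection number of two series with their slopes. This is
done with weights \<open>p\<close> and \<open>q\<close> for \<open>x\<close> and \<open>y\<close>:

  \<^item> if \<open>f\<close> and \<open>g\<close> have weighted orders at least \<open>A\<close> and \<open>B\<close>, then \<open>p q (f, g) \<ge> A B\<close>
    (\<open>weight_bezout\<close>); this gives the inequality;

  \<^item> if the weighted initial forms of \<open>f\<close> and \<open>g\<close> are the monomials \<open>x\<^sup>k\<close> and \<open>y\<^sup>l\<close>, then
    \<open>(f, g) = k l\<close> (\<open>quotient_dim_initial_powers\<close>); with a weight between two different slopes it
    gives equality.

For the semigroup, \<open>m(f)\<close> is its least nonzero element, and the supremum of \<open>(f, W)\<close> over the smooth
branches is the least element that is not divisible by \<open>m(f)\<close>, or \<open>\<infinity>\<close> if there is none. Indeed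
such an element is an upper bound (\<open>int_num_smooth_le\<close>). On the other hand, if \<open>m(f)\<close> divides
\<open>(f, W)\<close>, then the initial form of \<open>f\<close> with respect to the slope has a factor \<open>y - c x\<^sup>q\<close>, because \<open>K\<close>
is algebraically closed, or it is a multiple of a power of \<open>x\<close>; and this factor \<open>y - c x\<^sup>q\<close> or \<open>x\<close> defines a smooth branch of larger contact
(\<open>smooth_increase_contact\<close>); so a finite maximum is not divisible by \<open>m(f)\<close>.

All existence statements about power series, such as units, division, factorizations and inverse
substitutions, come from one fixed-point principle for maps that raise the weight of differences
(\<open>contraction_fixpoint\<close>).
\<close>

section \<open>Coefficients and monomials\<close>

abbreviation coef :: "'a::zero fps fps \<Rightarrow> nat \<Rightarrow> nat \<Rightarrow> 'a" where
  "coef f i j \<equiv> f $ j $ i"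

definition X2 :: "'a::field fps2" where
  "X2 = fps_const fps_X"

definition Y2 :: "'a::field fps2" where
  "Y2 = fps_X"

definition of_coefs :: "(nat \<Rightarrow> nat \<Rightarrow> 'a) \<Rightarrow> 'a::zero fps fps" where
  "of_coefs c = Abs_fps (\<lambda>j. Abs_fps (\<lambda>i. c i j))"

text \<open>
The weighted order, for weights \<open>p\<close> of \<open>x\<close> and \<open>q\<close> of \<open>y\<close>, is used only through lower bounds. This
avoids a special value for the zero series, and makes each level of the filtration closed under
addition.
\<close>

definition weight_ge :: "nat \<Rightarrow> nat \<Rightarrow> nat \<Rightarrow> 'a::field fps2 \<Rightarrow> bool" where
  "weight_ge p q N f \<longleftrightarrow> (\<forall>i j. coef f i j \<noteq> 0 \<longrightarrow> N \<le> p * i + q * j)"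

lemma fps2_eqI: "(\<And>i j. coef f i j = coef g i j) \<Longrightarrow> f = g"
  by (simp add: fps_eq_iff)

lemma coef_of_coefs [simp]: "coef (of_coefs c) i j = c i j"
  by (simp add: of_coefs_def)

lemma coef_mult:
  "coef (f * g) i j = (\<Sum>l=0..j. \<Sum>k=0..i. coef f k l * coef g (i - k) (j - l))"
  by (simp add: fps_mult_nth fps_sum_nth)

lemma coef_mult_0_0 [simp]: "coef (f * g) 0 0 = coef f 0 0 * coef g 0 0"
  by (simp add: coef_mult)

lemma coef_scale [simp]: "coef (scale_fps2 c f) i j = c * coef f i j"
  by (simp add: scale_fps2_def)

lemma coef_X2_power_mult [simp]: "coef (X2 ^ a * f) i j = (if i < a then 0 else coef f (i - a) j)"
  by (simp add: X2_def fps_X_power_mult_nth)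

lemma coef_Y2_power_mult [simp]: "coef (Y2 ^ b * f) i j = (if j < b then 0 else coef f i (j - b))"
  by (simp add: Y2_def fps_X_power_mult_nth)

lemma coef_one: "coef 1 i j = (if i = 0 \<and> j = 0 then 1 else 0)"
  by (simp add: fps_one_nth)

lemma coef_X2_power [simp]: "coef (X2 ^ a) i j = (if i = a \<and> j = 0 then 1 else 0)"
  using coef_X2_power_mult[where a = a and f = 1 and i = i and j = j] by (auto simp: coef_one split: if_splits)

lemma coef_Y2_power [simp]: "coef (Y2 ^ b) i j = (if i = 0 \<and> j = b then 1 else 0)"
  using coef_Y2_power_mult[where b = b and f = 1 and i = i and j = j] by (auto simp: coef_one split: if_splits)

lemma coef_monomial: "coef (X2 ^ a * Y2 ^ b) i j = (if i = a \<and> j = b then 1 else 0)"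
  by (auto simp: coef_Y2_power)

lemma coef_X2 [simp]: "coef X2 i j = (if i = 1 \<and> j = 0 then 1 else 0)"
  using coef_X2_power[where a = 1 and i = i and j = j] by simp

lemma coef_Y2 [simp]: "coef Y2 i j = (if i = 0 \<and> j = 1 then 1 else 0)"
  using coef_Y2_power[where b = 1 and i = i and j = j] by simp

section \<open>Weight filtrations and fixed points of contractions\<close>

lemma weight_geD: "weight_ge p q N f \<Longrightarrow> p * i + q * j < N \<Longrightarrow> coef f i j = 0"
  by (meson weight_ge_def not_le)

lemma weight_geI: "(\<And>i j. coef f i j \<noteq> 0 \<Longrightarrow> N \<le> p * i + q * j) \<Longrightarrow> weight_ge p q N f"
  by (simp add: weight_ge_def)

lemma weight_ge_0_left [simp]: "weight_ge p q 0 f"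
  by (simp add: weight_ge_def)

lemma weight_ge_0_right [simp]: "weight_ge p q N 0"
  by (simp add: weight_ge_def)

lemma weight_ge_mono: "weight_ge p q N f \<Longrightarrow> M \<le> N \<Longrightarrow> weight_ge p q M f"
  by (meson weight_ge_def le_trans)

lemma weight_ge_add: "weight_ge p q N f \<Longrightarrow> weight_ge p q N g \<Longrightarrow> weight_ge p q N (f + g)"
  unfolding weight_ge_def by (metis add.right_neutral fps_add_nth)

lemma weight_ge_uminus: "weight_ge p q N f \<Longrightarrow> weight_ge p q N (- f)"
  unfolding weight_ge_def by simp

lemma weight_ge_diff: "weight_ge p q N f \<Longrightarrow> weight_ge p q N g \<Longrightarrow> weight_ge p q N (f - g)"
  using weight_ge_add[of p q N f "- g"] weight_ge_uminus by auto

lemma weight_ge_sum: "(\<And>s. s \<in> S \<Longrightarrow> weight_ge p q N (f s)) \<Longrightarrow> weight_ge p q N (sum f S)"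
  by (induction S rule: infinite_finite_induct) (auto intro: weight_ge_add)

lemma weight_ge_mult:
  assumes "weight_ge p q M f" "weight_ge p q N g"
  shows "weight_ge p q (M + N) (f * g)"
proof (rule weight_geI)
  fix i j assume "coef (f * g) i j \<noteq> 0"
  then obtain l where "l \<le> j" "(\<Sum>k=0..i. coef f k l * coef g (i - k) (j - l)) \<noteq> 0"
    unfolding coef_mult by (metis (no_types, lifting) atLeastAtMost_iff sum.not_neutral_contains_not_neutral)
  then obtain k where kl: "k \<le> i" "coef f k l * coef g (i - k) (j - l) \<noteq> 0"
    by (metis (no_types, lifting) atLeastAtMost_iff sum.not_neutral_contains_not_neutral)
  hence "M \<le> p * k + q * l" "N \<le> p * (i - k) + q * (j - l)"
    using assms by (auto simp: weight_ge_def)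
  moreover have "p * i = p * k + p * (i - k)" "q * j = q * l + q * (j - l)"
    using kl \<open>l \<le> j\<close> by (metis add_mult_distrib2 le_add_diff_inverse)+
  ultimately show "M + N \<le> p * i + q * j"
    by linarith
qed

lemma weight_ge_mult_right: "weight_ge p q N g \<Longrightarrow> weight_ge p q N (f * g)"
  using weight_ge_mult[of p q 0 f N g] by simp

lemma weight_ge_power: "weight_ge p q N f \<Longrightarrow> weight_ge p q (n * N) (f ^ n)"
  by (induction n) (auto intro: weight_ge_mult)

lemma eq_0_if_weight_ge_all:
  assumes "\<And>N. weight_ge p q N f"
  shows "f = 0"
proof (rule fps2_eqI)
  fix i j show "coef f i j = coef 0 i j"
    using weight_geD[OF assms[of "Suc (p * i + q * j)"], of i j] by simp
qed

text \<open>
The iterates of \<open>T\<close> on \<open>0\<close> stabilize in each weight because a further step changes only monomials of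
larger weight. The fixed point takes from each iterate the coefficients that have become final. Only
one space of series is involved, so a system of equations has to be encoded in one unknown.
\<close>

lemma contraction_fixpoint:
  fixes T :: "'a::field fps2 \<Rightarrow> 'a fps2"
  assumes closed: "\<And>z. weight_ge p q M z \<Longrightarrow> weight_ge p q M (T z)"
    and contr: "\<And>z z' N. weight_ge p q M z \<Longrightarrow> weight_ge p q M z' \<Longrightarrow>
                  weight_ge p q N (z - z') \<Longrightarrow> weight_ge p q (Suc N) (T z - T z')"
  obtains z where "weight_ge p q M z" "T z = z"
proof -
  define s where "s n = (T ^^ n) 0" for n
  have s_Suc: "s (Suc n) = T (s n)" for n
    by (simp add: s_def)
  have sM: "weight_ge p q M (s n)" for n
    by (induction n) (auto simp: s_Suc closed, simp add: s_def)
  have step: "weight_ge p q n (s (Suc n) - s n)" for n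
  proof (induction n)
    case (Suc n)
    show ?case
      using contr[OF sM sM Suc] by (simp only: s_Suc)
  qed simp
  have stable: "weight_ge p q n (s (n + k) - s n)" for n k
  proof (induction k)
    case (Suc k)
    have "s (n + Suc k) - s n = (s (Suc (n + k)) - s (n + k)) + (s (n + k) - s n)"
      by simp
    thus ?case
      using weight_ge_add[OF weight_ge_mono[OF step[of "n + k"], of n] Suc] by (simp only: le_add1)
  qed simp
  define z where "z = of_coefs (\<lambda>i j. coef (s (Suc (p * i + q * j))) i j)"
  have near: "weight_ge p q n (z - s n)" for n
  proof (rule weight_geI, rule ccontr)
    fix i j assume nz: "coef (z - s n) i j \<noteq> 0" and "\<not> n \<le> p * i + q * j"
    then obtain k where n: "n = Suc (p * i + q * j) + k"
      by (metis less_iff_Suc_add not_le add_Suc)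
    have "coef (s n - s (Suc (p * i + q * j))) i j = 0"
      by (rule weight_geD[OF stable[of "Suc (p * i + q * j)" k, folded n]]) simp
    with nz show False
      by (simp add: z_def)
  qed
  have zM: "weight_ge p q M z"
    using weight_ge_add[OF near[of M] sM[of M]] by simp
  have "T z - z = 0"
  proof (rule eq_0_if_weight_ge_all)
    fix N
    have "weight_ge p q (Suc N) ((T z - T (s N)) - (z - s (Suc N)))"
      by (rule weight_ge_diff[OF contr[OF zM sM near[of N]] near[of "Suc N"]])
    hence "weight_ge p q N ((T z - T (s N)) - (z - s (Suc N)))"
      by (rule weight_ge_mono) simp
    thus "weight_ge p q N (T z - z)"
      by (simp add: s_Suc)
  qed
  with zM that show thesis
    by simp
qed

section \<open>Units and orders\<close>

text \<open>
A series with nonzero constant term is a constant times \<open>1 - r\<close> with \<open>r\<close> of positive order; the fixed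
point of \<open>z = 1 + r z\<close> is the geometric series that inverts it.
\<close>

lemma unit_iff: "f dvd (1 :: 'a::field fps2) \<longleftrightarrow> coef f 0 0 \<noteq> 0"
proof
  assume "f dvd 1"
  then obtain g where "1 = f * g" by (elim dvdE)
  hence "coef f 0 0 * coef g 0 0 = 1"
    by (metis coef_mult_0_0 coef_one)
  thus "coef f 0 0 \<noteq> 0" by auto
next
  assume nz: "coef f 0 0 \<noteq> 0"
  define c r where "c = inverse (coef f 0 0)" and "r = 1 - scale_fps2 c f"
  have r: "weight_ge 1 1 1 r"
    using nz by (intro weight_geI) (auto simp: r_def c_def coef_one split: if_splits intro: Suc_leI)
  obtain z where z: "1 + r * z = z"
  proof (rule contraction_fixpoint[of 1 1 0 "\<lambda>z. 1 + r * z"])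
    fix z z' :: "'a fps2" and N assume "weight_ge 1 1 N (z - z')"
    from weight_ge_mult[OF r this] show "weight_ge 1 1 (Suc N) (1 + r * z - (1 + r * z'))"
      by (simp add: algebra_simps)
  qed auto
  hence "1 = scale_fps2 c f * z"
    by (simp add: r_def algebra_simps)
  also have "\<dots> = f * (fps_const (fps_const c) * z)"
    by (simp add: scale_fps2_def mult_ac)
  finally show "f dvd 1"
    by (metis dvd_triv_left)
qed

lemma weight_ge_fps2_ord: "f \<noteq> 0 \<Longrightarrow> weight_ge 1 1 N f \<longleftrightarrow> N \<le> fps2_ord f"
proof -
  assume "f \<noteq> 0"
  then obtain a b where "f $ a $ b \<noteq> 0"
    by (auto simp: fps_eq_iff)
  hence ex: "\<exists>n i j. i + j = n \<and> f $ i $ j \<noteq> 0"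
    by blast
  have "\<exists>i j. i + j = fps2_ord f \<and> f $ i $ j \<noteq> 0"
    unfolding fps2_ord_def by (rule LeastI_ex) (rule ex)
  then obtain j i where "j + i = fps2_ord f" "coef f i j \<noteq> 0"
    by blast
  hence "i + j = fps2_ord f" "coef f i j \<noteq> 0"
    by simp_all
  moreover have "fps2_ord f \<le> i + j" if "coef f i j \<noteq> 0" for i j
    unfolding fps2_ord_def by (rule Least_le) (use that in \<open>metis add.commute\<close>)
  ultimately show ?thesis
    unfolding weight_ge_def mult_1 by (metis order.trans)
qed

lemma fps2_ord_attained: "f \<noteq> 0 \<Longrightarrow> \<exists>i j. i + j = fps2_ord f \<and> coef f i j \<noteq> 0"
  using weight_ge_fps2_ord[of f "Suc (fps2_ord f)"] weight_ge_fps2_ord[of f "fps2_ord f"]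
  by (auto simp: weight_ge_def not_less_eq_eq) (metis order_antisym)

section \<open>Codimension of ideals\<close>

interpretation fps2: vector_space "scale_fps2 :: 'a::field \<Rightarrow> 'a fps2 \<Rightarrow> 'a fps2"
  by (rule vector_space_fps2)

lemma ideal_gen_pair: "h \<in> ideal_gen {f, g} \<longleftrightarrow> (\<exists>u v. h = f * u + g * v)"
proof -
  interpret module "(*) :: 'a fps2 \<Rightarrow> 'a fps2 \<Rightarrow> 'a fps2"
    by (rule module_fps2)
  have "h \<in> ideal_gen {f, g} \<longleftrightarrow> (\<exists>k. h - k * f \<in> span {g})"
    by (simp add: ideal_gen_def span_insert)
  also have "\<dots> \<longleftrightarrow> (\<exists>u v. h - u * f = v * g)"
    by (auto simp: span_singleton)
  also have "\<dots> \<longleftrightarrow> (\<exists>u v. h = f * u + g * v)"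
    by (auto simp: algebra_simps)
  finally show ?thesis .
qed

lemma subspace_ideal_gen: "fps2.subspace (ideal_gen J)"
proof -
  interpret M: module "(*) :: 'a fps2 \<Rightarrow> 'a fps2 \<Rightarrow> 'a fps2"
    by (rule module_fps2)
  show ?thesis
    unfolding fps2.subspace_def ideal_gen_def scale_fps2_def
    by (auto intro: M.span_zero M.span_add M.span_scale)
qed

text \<open>
A spanning family is the counterpart, for upper bounds on the codimension, of the independent families
in the definition of \<open>quotient_dim\<close>.
\<close>

definition spans_mod :: "'a::field fps2 set \<Rightarrow> 'a fps2 set \<Rightarrow> bool" where
  "spans_mod I B \<longleftrightarrow> (\<forall>h. \<exists>s\<in>fps2.span B. h - s \<in> I)"

lemma spans_mod_remove:
  assumes I: "fps2.subspace I" and B: "finite B" "spans_mod I B"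
    and dep: "(\<Sum>b\<in>B. scale_fps2 (c b) b) \<in> I" "s \<in> B" "c s \<noteq> 0"
  shows "spans_mod I (B - {s})"
  unfolding spans_mod_def
proof
  fix h
  define r where "r = (\<Sum>b\<in>B - {s}. scale_fps2 (c b / c s) b)"
  have "s + r = scale_fps2 (1 / c s) (\<Sum>b\<in>B. scale_fps2 (c b) b)"
    using dep(3) unfolding r_def sum.remove[OF B(1) dep(2)]
    by (simp add: fps2.scale_right_distrib fps2.scale_sum_right)
  with dep(1) I have rI: "s + r \<in> I"
    by (simp add: fps2.subspace_scale)
  have rB: "r \<in> fps2.span (B - {s})"
    unfolding r_def by (intro fps2.span_sum fps2.span_scale fps2.span_base)
  obtain t where t: "t \<in> fps2.span B" "h - t \<in> I"
    using B(2) by (auto simp: spans_mod_def)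
  obtain k where k: "t - scale_fps2 k s \<in> fps2.span (B - {s})"
    using fps2.span_breakdown[OF dep(2) t(1)] by blast
  define t' where "t' = t - scale_fps2 k s - scale_fps2 k r"
  have "h - t' = (h - t) + scale_fps2 k (s + r)"
    by (simp add: t'_def fps2.scale_right_distrib)
  hence "h - t' \<in> I"
    using fps2.subspace_add[OF I t(2) fps2.subspace_scale[OF I rI]] by (simp only:)
  moreover have "t' \<in> fps2.span (B - {s})"
    unfolding t'_def by (rule fps2.span_diff[OF k fps2.span_scale[OF rB]])
  ultimately show "\<exists>s'\<in>fps2.span (B - {s}). h - s' \<in> I"
    by blast
qed

text \<open>
A spanning set that is not independent remains spanning after one element is dropped, so it may be
thinned to a basis.
\<close>

lemma quotient_dim_le_if_spans:
  fixes B :: "'a::field fps2 set"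
  assumes "finite B" "spans_mod (ideal_gen J) B"
  shows "quotient_dim (ideal_gen J) \<le> enat (card B)"
  using assms
proof (induction "card B" arbitrary: B rule: less_induct)
  case less
  show ?case
  proof (cases "independent_mod (ideal_gen J) B")
    case True
    have "\<exists>c. h - (\<Sum>b\<in>B. scale_fps2 (c b) b) \<in> ideal_gen J" for h
      using less.prems by (fastforce simp: spans_mod_def fps2.span_finite)
    from quotient_dim_eq_card_basis[OF less.prems(1) True this] show ?thesis
      by simp
  next
    case False
    then obtain c s where c: "(\<Sum>b\<in>B. scale_fps2 (c b) b) \<in> ideal_gen J" "s \<in> B" "c s \<noteq> 0"
      by (auto simp: independent_mod_def)
    have lt: "card (B - {s}) < card B"
      using c(2) less.prems(1) by (intro card_Diff1_less)
    have "quotient_dim (ideal_gen J) \<le> enat (card (B - {s}))"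
      using lt less.prems(1) spans_mod_remove[OF subspace_ideal_gen less.prems c]
      by (intro less.hyps) auto
    also have "\<dots> \<le> enat (card B)"
      using lt by simp
    finally show ?thesis .
  qed
qed

text \<open>
An independent set of the largest size spans, since any residue class outside its span could be added.
\<close>

lemma spans_if_quotient_dim_le:
  fixes J :: "'a::field fps2 set"
  assumes "quotient_dim (ideal_gen J) \<le> enat n"
  obtains B where "finite B" "card B \<le> n" "spans_mod (ideal_gen J) B"
proof -
  let ?P = "\<lambda>S. finite S \<and> independent_mod (ideal_gen J) S"
  have le: "card S \<le> n" if "?P S" for S
  proof -
    have "enat (card S) \<le> quotient_dim (ideal_gen J)"
      unfolding quotient_dim_def by (rule SUP_upper) (use that in simp)
    thus ?thesis
      using assms by (metis enat_ord_simps(1) order.trans)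
  qed
  have "\<exists>B. ?P B \<and> (\<forall>S. ?P S \<longrightarrow> card S \<le> card B)"
    by (rule ex_has_greatest_nat[of ?P "{}" card "Suc n"])
       (auto simp: independent_mod_def le_imp_less_Suc le)
  then obtain B where B: "finite B" "independent_mod (ideal_gen J) B"
    and max: "\<And>S. ?P S \<Longrightarrow> card S \<le> card B" by blast
  have "spans_mod (ideal_gen J) B"
    unfolding spans_mod_def
  proof (intro allI, rule ccontr)
    fix h assume no: "\<not> (\<exists>s\<in>fps2.span B. h - s \<in> ideal_gen J)"
    have "0 \<in> ideal_gen J"
      by (rule fps2.subspace_0[OF subspace_ideal_gen])
    hence hB: "h \<notin> B"
      using no by (metis diff_self fps2.span_base)
    have "independent_mod (ideal_gen J) (insert h B)"
      unfolding independent_mod_def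
    proof (intro allI impI)
      fix c assume "(\<Sum>s\<in>insert h B. scale_fps2 (c s) s) \<in> ideal_gen J"
      hence c: "scale_fps2 (c h) h + (\<Sum>s\<in>B. scale_fps2 (c s) s) \<in> ideal_gen J"
        using B(1) hB by simp
      have "c h = 0"
      proof (rule ccontr)
        assume nz: "c h \<noteq> 0"
        define t where "t = (\<Sum>s\<in>B. scale_fps2 (- c s / c h) s)"
        have "h - t = scale_fps2 (1 / c h) (scale_fps2 (c h) h + (\<Sum>s\<in>B. scale_fps2 (c s) s))"
          using nz by (simp add: t_def fps2.scale_right_distrib fps2.scale_sum_right
                                 fps2.scale_minus_left sum_negf)
        hence "h - t \<in> ideal_gen J"
          using c by (simp add: fps2.subspace_scale[OF subspace_ideal_gen])
        moreover have "t \<in> fps2.span B"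
          unfolding t_def by (intro fps2.span_sum fps2.span_scale fps2.span_base)
        ultimately show False
          using no by blast
      qed
      with c have "\<forall>s\<in>B. c s = 0"
        using B(2) by (simp add: independent_mod_def)
      with \<open>c h = 0\<close> show "\<forall>s\<in>insert h B. c s = 0"
        by simp
    qed
    with max[of "insert h B"] B(1) hB show False
      by simp
  qed
  with B le that show thesis
    by blast
qed

text \<open>
This is the exact sequence \<open>A/(f, h) \<longrightarrow> A/(f, g h) \<longrightarrow> A/(f, g) \<longrightarrow> 0\<close> with multiplication by \<open>g\<close> on the
left: multiples by \<open>g\<close> of a spanning set of the first term, together with a spanning set of the last
term, span the middle one.
\<close>

lemma quotient_dim_mult_le:
  fixes f :: "'a::field fps2"
  assumes "quotient_dim (ideal_gen {f, g}) \<le> enat a" "quotient_dim (ideal_gen {f, h}) \<le> enat b"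
  shows "quotient_dim (ideal_gen {f, g * h}) \<le> enat (a + b)"
proof -
  obtain B where B: "finite B" "card B \<le> a" "spans_mod (ideal_gen {f, g}) B"
    using spans_if_quotient_dim_le[OF assms(1)] .
  obtain C where C: "finite C" "card C \<le> b" "spans_mod (ideal_gen {f, h}) C"
    using spans_if_quotient_dim_le[OF assms(2)] .
  have gC: "g * s \<in> fps2.span ((*) g ` C)" if "s \<in> fps2.span C" for s
    using that
  proof (induction rule: fps2.span_induct_alt)
    case (step c x y)
    have "g * (scale_fps2 c x + y) = scale_fps2 c (g * x) + g * y"
      by (simp add: scale_fps2_def algebra_simps)
    with step show ?case
      by (auto intro: fps2.span_add fps2.span_scale fps2.span_base)
  qed (simp add: fps2.span_zero)
  have "spans_mod (ideal_gen {f, g * h}) (B \<union> (*) g ` C)"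
    unfolding spans_mod_def
  proof
    fix x
    obtain s u v where s: "s \<in> fps2.span B" "x - s = f * u + g * v"
      using B(3) unfolding spans_mod_def ideal_gen_pair by blast
    obtain t u' v' where t: "t \<in> fps2.span C" "v - t = f * u' + h * v'"
      using C(3) unfolding spans_mod_def ideal_gen_pair by blast
    have "g * v = g * t + g * (f * u' + h * v')"
      by (simp add: t(2)[symmetric] algebra_simps)
    hence "x - (s + g * t) = f * (u + g * u') + g * h * v'"
      using s(2) by (simp add: algebra_simps)
    moreover have "s + g * t \<in> fps2.span (B \<union> (*) g ` C)"
      using s(1) gC[OF t(1)] by (intro fps2.span_add) (auto intro: fps2.span_mono[THEN subsetD])
    ultimately show "\<exists>s\<in>fps2.span (B \<union> (*) g ` C). x - s \<in> ideal_gen {f, g * h}"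
      unfolding ideal_gen_pair by blast
  qed
  hence "quotient_dim (ideal_gen {f, g * h}) \<le> enat (card (B \<union> (*) g ` C))"
    using B(1) C(1) by (intro quotient_dim_le_if_spans) auto
  also have "card (B \<union> (*) g ` C) \<le> a + b"
    using card_Un_le[of B "(*) g ` C"] card_image_le[OF C(1), of "(*) g"] B(2) C(2) by linarith
  finally show ?thesis
    by simp
qed

lemma quotient_dim_unit:
  assumes "g dvd (1 :: 'a::field fps2)"
  shows "quotient_dim (ideal_gen {f, g}) = 0"
proof -
  obtain k where k: "1 = g * k"
    using assms by (elim dvdE)
  have "h - 0 \<in> ideal_gen {f, g}" for h
    unfolding ideal_gen_pair
    by (rule exI[of _ 0], rule exI[of _ "k * h"]) (simp add: mult.assoc[symmetric] k[symmetric])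
  hence "spans_mod (ideal_gen {f, g}) {}"
    by (auto simp: spans_mod_def)
  from quotient_dim_le_if_spans[OF _ this] show ?thesis
    by (simp flip: zero_enat_def)
qed

lemma quotient_dim_power_le:
  assumes "quotient_dim (ideal_gen {f, g}) \<le> enat d"
  shows "quotient_dim (ideal_gen {f, g ^ n}) \<le> enat (n * d)"
proof (induction n)
  case 0
  show ?case by (simp add: quotient_dim_unit)
next
  case (Suc n)
  from quotient_dim_mult_le[OF assms Suc] show ?case by simp
qed

text \<open>
Independence of monomials modulo \<open>I\<close> means that no nonzero element of \<open>I\<close> is supported on them.
\<close>

lemma card_le_quotient_dim:
  fixes I :: "'a::field fps2 set"
  assumes "finite P" and "\<And>h. h \<in> I \<Longrightarrow> (\<And>i j. coef h i j \<noteq> 0 \<Longrightarrow> (i, j) \<in> P) \<Longrightarrow> h = 0"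
  shows "enat (card P) \<le> quotient_dim I"
proof -
  define mon :: "nat \<times> nat \<Rightarrow> 'a fps2" where "mon = (\<lambda>(i, j). X2 ^ i * Y2 ^ j)"
  have coef_mon: "coef (mon ij) i j = (if ij = (i, j) then 1 else 0)" for ij i j
    by (cases ij) (auto simp: mon_def coef_monomial)
  have inj: "inj mon"
    by (rule injI) (metis coef_mon prod.exhaust zero_neq_one)
  have "independent_mod I (mon ` P)"
    unfolding independent_mod_def
  proof (intro allI impI ballI)
    fix c s assume sum: "(\<Sum>s\<in>mon ` P. scale_fps2 (c s) s) \<in> I" and s: "s \<in> mon ` P"
    define h where "h = (\<Sum>s\<in>mon ` P. scale_fps2 (c s) s)"
    have "h = (\<Sum>ij\<in>P. scale_fps2 (c (mon ij)) (mon ij))"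
      unfolding h_def using inj by (subst sum.reindex) (auto intro: inj_on_subset)
    hence coef_h: "coef h i j = (if (i, j) \<in> P then c (mon (i, j)) else 0)" for i j
      by (simp add: fps_sum_nth coef_mon if_distrib sum.delta[OF assms(1)] cong: if_cong)
    have "h = 0"
      using sum by (intro assms(2)) (auto simp: coef_h h_def[symmetric] split: if_splits)
    obtain i j where "(i, j) \<in> P" "s = mon (i, j)"
      using s by auto
    with coef_h[where i = i and j = j] \<open>h = 0\<close> show "c s = 0"
      by simp
  qed
  hence "enat (card (mon ` P)) \<le> quotient_dim I"
    unfolding quotient_dim_def by (intro SUP_upper) (simp add: assms(1))
  thus ?thesis
    using inj by (simp add: card_image inj_on_subset)
qed

section \<open>A lower bound for intersection numbers\<close>

text \<open>
The monomial \<open>x\<^sup>a y\<^sup>b\<close> has minimal weight in \<open>f\<close> and the largest \<open>y\<close>-degree among the monomials of this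
weight. The second condition makes leading monomials unique and multiplicative.
\<close>

definition leads :: "nat \<Rightarrow> nat \<Rightarrow> 'a::field fps2 \<Rightarrow> nat \<Rightarrow> nat \<Rightarrow> bool" where
  "leads p q f a b \<longleftrightarrow> coef f a b \<noteq> 0 \<and>
     (\<forall>i j. coef f i j \<noteq> 0 \<longrightarrow> p * a + q * b < p * i + q * j \<or> p * a + q * b = p * i + q * j \<and> j \<le> b)"

lemma weight_ge_leads: "leads p q f a b \<Longrightarrow> weight_ge p q (p * a + q * b) f"
  by (force simp: leads_def weight_ge_def)

lemma leads_exists:
  assumes "f \<noteq> 0" "q > 0"
  obtains a b where "leads p q f a b"
proof -
  define w where "w = (LEAST w. \<exists>i j. coef f i j \<noteq> 0 \<and> w = p * i + q * j)"
  have "\<exists>w i j. coef f i j \<noteq> 0 \<and> w = p * i + q * j"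
    using assms(1) by (auto simp: fps_eq_iff)
  hence "\<exists>i j. coef f i j \<noteq> 0 \<and> w = p * i + q * j"
    unfolding w_def by (rule LeastI_ex)
  hence ex: "\<exists>j i. coef f i j \<noteq> 0 \<and> w = p * i + q * j" by blast
  have w_le: "w \<le> p * i + q * j" if "coef f i j \<noteq> 0" for i j
    unfolding w_def by (rule Least_le) (use that in blast)
  have bound: "j < Suc w" if "w = p * i + q * j" for i j
  proof -
    have "j \<le> q * j" using assms(2) by simp
    with that show ?thesis by linarith
  qed
  obtain b where b: "\<exists>i. coef f i b \<noteq> 0 \<and> w = p * i + q * b"
    and max: "\<forall>j. (\<exists>i. coef f i j \<noteq> 0 \<and> w = p * i + q * j) \<longrightarrow> j \<le> b"
    using ex_has_greatest_nat[of "\<lambda>j. \<exists>i. coef f i j \<noteq> 0 \<and> w = p * i + q * j" _ "\<lambda>j. j" "Suc w"]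
      ex bound by blast
  then obtain a where "coef f a b \<noteq> 0" "w = p * a + q * b"
    by blast
  with w_le max have "leads p q f a b"
    unfolding leads_def by (metis le_neq_implies_less)
  with that show thesis .
qed

lemma coef_mult_leads:
  assumes "leads p q f a b" "leads p q g c d" "p > 0"
  shows "coef (f * g) (a + c) (b + d) \<noteq> 0"
proof -
  have unique: "k = a \<and> l = b"
    if "k \<le> a + c" "l \<le> b + d" "coef f k l \<noteq> 0" "coef g (a + c - k) (b + d - l) \<noteq> 0" for k l
  proof -
    obtain k' l' where k': "a + c = k + k'" "b + d = l + l'"
      using \<open>k \<le> a + c\<close> \<open>l \<le> b + d\<close> by (meson le_Suc_ex)
    have "p * a + p * c = p * k + p * k'" "q * b + q * d = q * l + q * l'"
      using k' by (metis add_mult_distrib2)+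
    moreover from assms(1) that(3) have
      "p * a + q * b < p * k + q * l \<or> p * a + q * b = p * k + q * l \<and> l \<le> b"
      by (simp add: leads_def)
    moreover from assms(2) that(4) k' have
      "p * c + q * d < p * k' + q * l' \<or> p * c + q * d = p * k' + q * l' \<and> l' \<le> d"
      by (simp add: leads_def)
    ultimately have eq: "p * a + q * b = p * k + q * l" and "l \<le> b" "l' \<le> d"
      by linarith+
    with k' have "l = b" by linarith
    with eq assms(3) show ?thesis by simp
  qed
  have "coef (f * g) (a + c) (b + d) =
          (\<Sum>l=0..b+d. \<Sum>k=0..a+c. if l = b \<and> k = a then coef f a b * coef g c d else 0)"
    unfolding coef_mult by (intro sum.cong refl) (use unique in force)
  also have "\<dots> = (\<Sum>l=0..b+d. if l = b then coef f a b * coef g c d else 0)"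
  proof (intro sum.cong refl)
    fix l
    show "(\<Sum>k=0..a+c. if l = b \<and> k = a then coef f a b * coef g c d else 0) =
          (if l = b then coef f a b * coef g c d else 0)"
      by (cases "l = b") (simp_all add: sum.delta)
  qed
  also have "\<dots> = coef f a b * coef g c d"
    by (simp add: sum.delta)
  also have "\<dots> \<noteq> 0"
    using assms by (simp add: leads_def)
  finally show ?thesis .
qed

text \<open>
The monomials of weight less than \<open>M\<close> that are not multiples of the leading monomial of \<open>f\<close> are
independent modulo \<open>f\<close> and all series of weight at least \<open>M\<close>: an element \<open>f u\<close> of smaller weight has a
leading monomial that is such a multiple.
\<close>

lemma card_staircase_le_quotient_dim:
  assumes f: "leads p q f a b" and g: "weight_ge p q M g" and pq: "p > 0" "q > 0"
    and P: "finite P" "\<And>i j. (i, j) \<in> P \<Longrightarrow> p * i + q * j < M \<and> (i < a \<or> j < b)"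
  shows "enat (card P) \<le> quotient_dim (ideal_gen {f, g})"
proof (rule card_le_quotient_dim[OF P(1)])
  fix h assume "h \<in> ideal_gen {f, g}" and supp: "\<And>i j. coef h i j \<noteq> 0 \<Longrightarrow> (i, j) \<in> P"
  then obtain u v where h: "h = f * u + g * v"
    by (auto simp: ideal_gen_pair)
  have gv: "weight_ge p q M (g * v)"
    using weight_ge_mult_right[OF g, of v] by (simp add: mult.commute)
  have "weight_ge p q M h"
  proof (cases "u = 0")
    case False
    then obtain c d where u: "leads p q u c d"
      using leads_exists pq(2) by blast
    have "coef (f * u) (a + c) (b + d) \<noteq> 0"
      by (rule coef_mult_leads[OF f u pq(1)])
    hence "\<not> p * (a + c) + q * (b + d) < M"
      using weight_geD[OF gv, of "a + c" "b + d"] supp[where i = "a + c" and j = "b + d"]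
        P(2)[of "a + c" "b + d"]
      by (auto simp: h)
    moreover have "weight_ge p q ((p * a + q * b) + (p * c + q * d)) (f * u)"
      by (intro weight_ge_mult weight_ge_leads f u)
    ultimately have "weight_ge p q M (f * u)"
      by (elim weight_ge_mono) (simp add: algebra_simps)
    with gv show ?thesis
      by (simp add: h weight_ge_add)
  qed (use gv h in simp)
  show "h = 0"
  proof (rule fps2_eqI, rule ccontr)
    fix i j assume "coef h i j \<noteq> coef 0 i j"
    hence "coef h i j \<noteq> 0" by simp
    with P(2)[OF supp[where i = i and j = j]] weight_geD[OF \<open>weight_ge p q M h\<close>, of i j] show False
      by blast
  qed
qed

text \<open>
The count of monomials outside the staircase of \<open>f\<close> is too small for \<open>g\<close> itself because of boundary
terms. It is applied to \<open>g\<^sup>n\<close> with \<open>n = p q N\<close>: then \<open>(f, g\<^sup>n) \<le> n (f, g)\<close>, while the staircase contains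
\<open>N (p a + q b) B\<close> monomials up to a constant, and \<open>N \<rightarrow> \<infinity>\<close> yields the bound.
\<close>

lemma weight_bezout:
  fixes f g :: "'a::field fps2"
  assumes f: "f \<noteq> 0" "weight_ge p q A f" and g: "weight_ge p q B g" and pq: "p > 0" "q > 0"
  shows "enat (A * B) \<le> enat (p * q) * quotient_dim (ideal_gen {f, g})"
proof (cases "quotient_dim (ideal_gen {f, g})")
  case infinity
  thus ?thesis using pq by (simp add: imult_is_infinity zero_enat_def)
next
  case (enat d)
  obtain a b where lead: "leads p q f a b"
    using leads_exists[OF f(1) pq(2)] .
  have A: "A \<le> p * a + q * b"
    using f(2) lead by (auto simp: weight_ge_def leads_def)
  define k where "k = a * (p * a + b) + b * (q * b)"
  have asym: "N * ((p * a + q * b) * B) \<le> k + N * (p * q * d)" for N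
  proof -
    \<comment> \<open>the part of the staircase below weight \<open>p q N B\<close> consists of two strips; they are cut a little short so that they are rectangles\<close>
    define P1 P2 where "P1 = {..<a} \<times> {b..<p * (N * B) - p * a}"
      and "P2 = {..<q * (N * B) - q * b} \<times> {..<b}"
    have disj: "P1 \<inter> P2 = {}" and fin: "finite P1" "finite P2"
      by (auto simp: P1_def P2_def)
    have card: "card (P1 \<union> P2) = a * (p * (N * B) - p * a - b) + (q * (N * B) - q * b) * b"
      by (subst card_Un_disjoint[OF fin disj]) (simp add: P1_def P2_def card_cartesian_product)
    have low: "p * i + q * j < p * q * N * B \<and> (i < a \<or> j < b)" if "(i, j) \<in> P1 \<union> P2" for i j
    proof (cases "(i, j) \<in> P1")
      case True
      hence i: "i < a" and j: "j + p * a < p * (N * B)"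
        by (auto simp: P1_def)
      from j pq(2) have "q * (j + p * a) < q * (p * (N * B))"
        by simp
      moreover have "p * a \<le> q * (p * a)" using pq(2) by simp
      moreover have "p * i \<le> p * a" using i by simp
      ultimately have "p * i + q * j < q * (p * (N * B))"
        unfolding add_mult_distrib2 by linarith
      with i show ?thesis by (simp add: mult_ac)
    next
      case False
      hence j: "j < b" and i: "i + q * b < q * (N * B)"
        using that by (auto simp: P2_def)
      from i pq(1) have "p * (i + q * b) < p * (q * (N * B))"
        by simp
      moreover have "q * b \<le> p * (q * b)" using pq(1) by simp
      moreover have "q * j \<le> q * b" using j by simp
      ultimately have "p * i + q * j < p * (q * (N * B))"
        unfolding add_mult_distrib2 by linarith
      with j show ?thesis by (simp add: mult_ac)
    qed
    have "enat (card (P1 \<union> P2)) \<le> quotient_dim (ideal_gen {f, g ^ (p * q * N)})"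
      by (rule card_staircase_le_quotient_dim[OF lead weight_ge_power[OF g] pq _ low])
         (use fin in auto)
    also have "\<dots> \<le> enat ((p * q * N) * d)"
      by (rule quotient_dim_power_le) (simp add: enat)
    finally have "a * (p * (N * B) - p * a - b) + (q * (N * B) - q * b) * b \<le> (p * q * N) * d"
      by (simp add: card)
    moreover have "a * (p * (N * B)) \<le> a * (p * (N * B) - p * a - b) + a * (p * a + b)"
      unfolding add_mult_distrib2[symmetric] by (intro mult_le_mono2) linarith
    moreover have "b * (q * (N * B)) \<le> (q * (N * B) - q * b) * b + b * (q * b)"
      unfolding mult.commute[of _ b] add_mult_distrib2[symmetric] by (intro mult_le_mono2) linarith
    ultimately have "a * (p * (N * B)) + b * (q * (N * B)) \<le> k + (p * q * N) * d"
      unfolding k_def by linarith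
    thus ?thesis by (simp add: algebra_simps)
  qed
  have "(p * a + q * b) * B \<le> p * q * d"
  proof (rule ccontr)
    assume "\<not> ?thesis"
    hence "Suc k * (p * q * d + 1) \<le> Suc k * ((p * a + q * b) * B)"
      by (intro mult_le_mono) auto
    with asym[of "Suc k"] show False
      unfolding add_mult_distrib2 by simp
  qed
  moreover have "A * B \<le> (p * a + q * b) * B"
    using A by (rule mult_le_mono1)
  ultimately have "A * B \<le> p * q * d"
    by linarith
  thus ?thesis
    by (simp add: enat)
qed

section \<open>Initial monomials\<close>

text \<open>
The initial form of \<open>f\<close> is a multiple of the single monomial \<open>x\<^sup>a y\<^sup>b\<close>, so \<open>(a, b)\<close> is a vertex of the
Newton polygon.
\<close>

definition initial :: "nat \<Rightarrow> nat \<Rightarrow> 'a::field fps2 \<Rightarrow> nat \<Rightarrow> nat \<Rightarrow> bool" where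
  "initial p q f a b \<longleftrightarrow> coef f a b \<noteq> 0 \<and>
     (\<forall>i j. coef f i j \<noteq> 0 \<longrightarrow> (i, j) = (a, b) \<or> p * a + q * b < p * i + q * j)"

text \<open>
Division by the monomials \<open>x\<^sup>k\<close> and \<open>y\<^sup>l\<close>: the multiples of \<open>y\<^sup>l\<close> go to \<open>y_part\<close>, the remaining multiples
of \<open>x\<^sup>k\<close> to \<open>x_part\<close>, and the rest to \<open>box_part\<close>. All parts depend linearly on the series.
\<close>

definition x_part :: "nat \<Rightarrow> nat \<Rightarrow> 'a::field fps2 \<Rightarrow> 'a fps2" where
  "x_part k l z = of_coefs (\<lambda>i j. if j < l then coef z (i + k) j else 0)"

definition y_part :: "nat \<Rightarrow> 'a::field fps2 \<Rightarrow> 'a fps2" where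
  "y_part l z = of_coefs (\<lambda>i j. coef z i (j + l))"

definition box_part :: "nat \<Rightarrow> nat \<Rightarrow> 'a::field fps2 \<Rightarrow> 'a fps2" where
  "box_part k l z = of_coefs (\<lambda>i j. if i < k \<and> j < l then coef z i j else 0)"

lemma monomial_division: "z = box_part k l z + X2 ^ k * x_part k l z + Y2 ^ l * y_part l z"
  by (rule fps2_eqI) (simp add: box_part_def x_part_def y_part_def)

lemma x_part_diff: "x_part k l z - x_part k l z' = x_part k l (z - z')"
  by (rule fps2_eqI) (simp add: x_part_def)

lemma y_part_diff: "y_part l z - y_part l z' = y_part l (z - z')"
  by (rule fps2_eqI) (simp add: y_part_def)

lemma weight_ge_x_part: "weight_ge p q N z \<Longrightarrow> weight_ge p q (N - p * k) (x_part k l z)"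
  by (force simp: weight_ge_def x_part_def algebra_simps split: if_splits)

lemma weight_ge_y_part: "weight_ge p q N z \<Longrightarrow> weight_ge p q (N - q * l) (y_part l z)"
  by (force simp: weight_ge_def y_part_def algebra_simps)

lemma weight_ge_scale: "weight_ge p q N f \<Longrightarrow> weight_ge p q N (scale_fps2 c f)"
  by (auto simp: weight_ge_def)

lemma scale_mult_left: "scale_fps2 c f * g = scale_fps2 c (f * g)"
  by (simp add: scale_fps2_def mult.assoc)

lemma scale_mult_right: "f * scale_fps2 c g = scale_fps2 c (f * g)"
  by (simp add: scale_fps2_def mult_ac)

lemma weight_ge_initial_rest:
  assumes "initial p q f a b"
  shows "weight_ge p q (Suc (p * a + q * b)) (f - scale_fps2 (coef f a b) (X2 ^ a * Y2 ^ b))"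
proof (rule weight_geI)
  fix i j assume "coef (f - scale_fps2 (coef f a b) (X2 ^ a * Y2 ^ b)) i j \<noteq> 0"
  hence "coef f i j \<noteq> 0" "(i, j) \<noteq> (a, b)"
    by (auto simp: coef_monomial split: if_splits)
  with assms show "Suc (p * a + q * b) \<le> p * i + q * j"
    unfolding initial_def by (metis Suc_leI)
qed

lemma weight_ge_initial: "initial p q f a b \<Longrightarrow> weight_ge p q (p * a + q * b) f"
  by (force simp: initial_def weight_ge_def)

lemma box_span:
  fixes z :: "'a::field fps2"
  shows "box_part k l z \<in> fps2.span ((\<lambda>(i, j). X2 ^ i * Y2 ^ j) ` ({..<k} \<times> {..<l}))"
proof -
  have "box_part k l z = (\<Sum>(i, j)\<in>{..<k} \<times> {..<l}. scale_fps2 (coef z i j) (X2 ^ i * Y2 ^ j))"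
  proof (rule fps2_eqI)
    fix i j
    have "coef (\<Sum>(i, j)\<in>{..<k} \<times> {..<l}. scale_fps2 (coef z i j) (X2 ^ i * Y2 ^ j)) i j =
          (\<Sum>ab\<in>{..<k} \<times> {..<l}. if ab = (i, j) then coef z i j else 0)"
      unfolding fps_sum_nth
      by (intro sum.cong refl) (auto simp: coef_monomial split: if_splits)
    also have "\<dots> = coef (box_part k l z) i j"
      by (simp add: box_part_def sum.delta)
    finally show "coef (box_part k l z) i j =
        coef (\<Sum>(i, j)\<in>{..<k} \<times> {..<l}. scale_fps2 (coef z i j) (X2 ^ i * Y2 ^ j)) i j" ..
  qed
  also have "\<dots> \<in> fps2.span ((\<lambda>(i, j). X2 ^ i * Y2 ^ j) ` ({..<k} \<times> {..<l}))"
  proof (rule fps2.span_sum)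
    fix ij assume "ij \<in> {..<k} \<times> {..<l}"
    hence "(case ij of (i, j) \<Rightarrow> X2 ^ i * Y2 ^ j)
        \<in> (\<lambda>(i, j). X2 ^ i * Y2 ^ j :: 'a fps2) ` ({..<k} \<times> {..<l})"
      by (rule imageI)
    thus "(case ij of (i, j) \<Rightarrow> scale_fps2 (coef z i j) (X2 ^ i * Y2 ^ j))
        \<in> fps2.span ((\<lambda>(i, j). X2 ^ i * Y2 ^ j) ` ({..<k} \<times> {..<l}))"
      by (cases ij) (simp add: fps2.span_scale fps2.span_base)
  qed
  finally show ?thesis .
qed

text \<open>
The box monomials \<open>x\<^sup>i y\<^sup>j\<close> with \<open>i < k\<close>, \<open>j < l\<close> span the quotient: division by \<open>x\<^sup>k\<close> and \<open>y\<^sup>l\<close>, with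
\<open>f\<close> and \<open>g\<close> in place of these monomials, leaves an error of larger weight, and hence can be
corrected by a fixed point. The lower bound is the weighted Bezout inequality.
\<close>

lemma quotient_dim_initial_powers:
  fixes f g :: "'a::field fps2"
  assumes f: "initial p q f k 0" and g: "initial p q g 0 l" and pq: "p > 0" "q > 0"
  shows "quotient_dim (ideal_gen {f, g}) = enat (k * l)"
proof (rule antisym)
  define c d where "c = coef f k 0" and "d = coef g 0 l"
  have cd: "c \<noteq> 0" "d \<noteq> 0"
    using f g by (auto simp: c_def d_def initial_def)
  define f' g' where "f' = f - scale_fps2 c (X2 ^ k)" and "g' = g - scale_fps2 d (Y2 ^ l)"
  have f': "weight_ge p q (Suc (p * k)) f'" and g': "weight_ge p q (Suc (q * l)) g'"
    using weight_ge_initial_rest[OF f] weight_ge_initial_rest[OF g]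
    by (simp_all add: f'_def g'_def c_def d_def)
  define u v where "u z = scale_fps2 (1 / c) (x_part k l z)"
    and "v z = scale_fps2 (1 / d) (y_part l z)" for z
  have u: "weight_ge p q (N - p * k) (u z - u z')" and v: "weight_ge p q (N - q * l) (v z - v z')"
    if "weight_ge p q N (z - z')" for N z z'
    unfolding u_def v_def fps2.scale_right_diff_distrib[symmetric] x_part_diff y_part_diff
    by (intro weight_ge_scale weight_ge_x_part weight_ge_y_part that)+
  have cofactors: "f * u z + g * v z = X2 ^ k * x_part k l z + Y2 ^ l * y_part l z
      + (f' * u z + g' * v z)" for z
  proof -
    have "f = scale_fps2 c (X2 ^ k) + f'" "g = scale_fps2 d (Y2 ^ l) + g'"
      by (simp_all add: f'_def g'_def)
    thus ?thesis
      using cd by (simp add: u_def v_def distrib_right scale_mult_left scale_mult_right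
                             fps2.scale_right_distrib add_ac)
  qed
  let ?B = "(\<lambda>(i, j). X2 ^ i * Y2 ^ j) ` ({..<k} \<times> {..<l}) :: 'a fps2 set"
  have "spans_mod (ideal_gen {f, g}) ?B"
    unfolding spans_mod_def
  proof
    fix h :: "'a fps2"
    obtain z where z: "h - f' * u z - g' * v z = z"
    proof (rule contraction_fixpoint[of p q 0 "\<lambda>z. h - f' * u z - g' * v z"])
      fix z z' :: "'a fps2" and N assume N: "weight_ge p q N (z - z')"
      have "weight_ge p q (Suc N) (f' * (u z - u z'))" "weight_ge p q (Suc N) (g' * (v z - v z'))"
        by (rule weight_ge_mono[OF weight_ge_mult[OF f' u[OF N]]]
                 weight_ge_mono[OF weight_ge_mult[OF g' v[OF N]]], simp)+
      from weight_ge_uminus[OF weight_ge_add[OF this]]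
      show "weight_ge p q (Suc N) (h - f' * u z - g' * v z - (h - f' * u z' - g' * v z'))"
        by (simp add: algebra_simps)
    qed auto
    have "h - box_part k l z = f * u z + g * v z"
      using z monomial_division[of z k l] unfolding cofactors by (simp add: algebra_simps)
    thus "\<exists>s\<in>fps2.span ?B. h - s \<in> ideal_gen {f, g}"
      using box_span unfolding ideal_gen_pair by blast
  qed
  hence "quotient_dim (ideal_gen {f, g}) \<le> enat (card ?B)"
    by (intro quotient_dim_le_if_spans) auto
  also have "card ?B \<le> k * l"
    using card_image_le[of "{..<k} \<times> {..<l}" "\<lambda>(i, j). X2 ^ i * Y2 ^ j :: 'a fps2"]
    by (simp add: card_cartesian_product)
  finally show "quotient_dim (ideal_gen {f, g}) \<le> enat (k * l)"
    by simp
next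
  have "f \<noteq> 0"
    using f by (auto simp: initial_def)
  with weight_bezout[OF _ weight_ge_initial[OF f] weight_ge_initial[OF g] pq]
  have "enat (p * q) * enat (k * l) \<le> enat (p * q) * quotient_dim (ideal_gen {f, g})"
    by (simp add: mult_ac)
  thus "enat (k * l) \<le> quotient_dim (ideal_gen {f, g})"
    using pq by (cases "quotient_dim (ideal_gen {f, g})") auto
qed

text \<open>
A version of Hensel's lemma: the factorization of the initial monomial \<open>x\<^sup>a y\<^sup>b\<close> lifts to one of \<open>f\<close>.
For \<open>f = x\<^sup>a y\<^sup>b + h\<close> the equation \<open>(x\<^sup>a + u) (y\<^sup>b + v) = f\<close> reads \<open>x\<^sup>a v + y\<^sup>b u = h - u v\<close>. Its right-hand
side is taken as the unknown \<open>z\<close>: every monomial of \<open>z\<close> has weight larger than that of \<open>x\<^sup>a y\<^sup>b\<close>, thus it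
is divisible by \<open>x\<^sup>a\<close> or \<open>y\<^sup>b\<close>, and \<open>u\<close> and \<open>v\<close> are the parts of \<open>z\<close>.
\<close>

lemma reducible_if_mixed_initial:
  fixes f :: "'a::field fps2"
  assumes f: "initial p q f a b" and ab: "a > 0" "b > 0"
  shows "\<not> irreducible f"
proof -
  define c where "c = coef f a b"
  have c: "c \<noteq> 0"
    using f by (simp add: c_def initial_def)
  define h where "h = scale_fps2 (1 / c) f - X2 ^ a * Y2 ^ b"
  have "h = scale_fps2 (1 / c) (f - scale_fps2 c (X2 ^ a * Y2 ^ b))"
    using c by (simp add: h_def fps2.scale_right_diff_distrib)
  hence h: "weight_ge p q (Suc (p * a + q * b)) h"
    using weight_ge_initial_rest[OF f] by (simp add: c_def weight_ge_scale)
  let ?u = "y_part b" and ?v = "x_part a b"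
  have u: "weight_ge p q (Suc (p * a)) (?u z)" and v: "weight_ge p q (Suc (q * b)) (?v z)"
    if "weight_ge p q (Suc (p * a + q * b)) z" for z :: "'a fps2"
    using weight_ge_y_part[OF that, of b] weight_ge_x_part[OF that, of a b]
    by (simp_all add: Suc_diff_le)
  obtain z where z: "weight_ge p q (Suc (p * a + q * b)) z" "h - ?u z * ?v z = z"
  proof (rule contraction_fixpoint[of p q "Suc (p * a + q * b)" "\<lambda>z. h - ?u z * ?v z"])
    fix z :: "'a fps2" assume z: "weight_ge p q (Suc (p * a + q * b)) z"
    show "weight_ge p q (Suc (p * a + q * b)) (h - ?u z * ?v z)"
      by (rule weight_ge_diff[OF h weight_ge_mono[OF weight_ge_mult[OF u[OF z] v[OF z]]]]) simp
  next
    fix z z' :: "'a fps2" and N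
    assume z: "weight_ge p q (Suc (p * a + q * b)) z" and z': "weight_ge p q (Suc (p * a + q * b)) z'"
      and N: "weight_ge p q N (z - z')"
    have "weight_ge p q (Suc N) (?u z * ?v (z - z'))"
      by (rule weight_ge_mono[OF weight_ge_mult[OF u[OF z] weight_ge_x_part[OF N]]]) simp
    moreover have "weight_ge p q (Suc N) (?u (z - z') * ?v z')"
      by (rule weight_ge_mono[OF weight_ge_mult[OF weight_ge_y_part[OF N] v[OF z']]]) simp
    ultimately have "weight_ge p q (Suc N) (- (?u z * ?v (z - z') + ?u (z - z') * ?v z'))"
      by (intro weight_ge_uminus weight_ge_add)
    thus "weight_ge p q (Suc N) (h - ?u z * ?v z - (h - ?u z' * ?v z'))"
      by (simp add: x_part_diff[symmetric] y_part_diff[symmetric] algebra_simps)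
  qed
  have "box_part a b z = 0"
  proof (rule fps2_eqI)
    fix i j
    have "coef z i j = 0" if "i < a" "j < b"
    proof (rule weight_geD[OF z(1)])
      have "p * i \<le> p * a" "q * j \<le> q * b" using that by simp_all
      thus "p * i + q * j < Suc (p * a + q * b)" by linarith
    qed
    thus "coef (box_part a b z) i j = coef 0 i j"
      by (simp add: box_part_def)
  qed
  with monomial_division[of z a b] have "z = X2 ^ a * ?v z + Y2 ^ b * ?u z"
    by simp
  hence "h = X2 ^ a * ?v z + Y2 ^ b * ?u z + ?u z * ?v z"
    using z(2) by (simp add: algebra_simps)
  hence "scale_fps2 (1 / c) f = (X2 ^ a + ?u z) * (Y2 ^ b + ?v z)"
    by (simp add: h_def algebra_simps)
  hence "f = scale_fps2 c ((X2 ^ a + ?u z) * (Y2 ^ b + ?v z))"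
    using c by (metis fps2.scale_scale fps2.scale_one nonzero_mult_div_cancel_left mult.right_neutral times_divide_eq_right)
  hence "f = (X2 ^ a + ?u z) * scale_fps2 c (Y2 ^ b + ?v z)"
    by (simp add: scale_mult_right)
  moreover have "coef (X2 ^ a + ?u z) 0 0 = 0" "coef (scale_fps2 c (Y2 ^ b + ?v z)) 0 0 = 0"
    using ab weight_geD[OF u[OF z(1)], of 0 0] weight_geD[OF v[OF z(1)], of 0 0]
    by (simp_all add: coef_X2_power coef_Y2_power)
  ultimately show ?thesis
    using unit_iff by (metis irreducibleD)
qed

lemma coef_0_0_irreducible: "irreducible (f :: 'a::field fps2) \<Longrightarrow> coef f 0 0 = 0"
  using unit_iff irreducible_not_unit by blast

lemma fps2_ord_le_coef: "coef f i j \<noteq> 0 \<Longrightarrow> fps2_ord f \<le> i + j"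
  using weight_ge_fps2_ord[of f "fps2_ord f"] by (cases "f = 0") (auto simp: weight_ge_def)

lemma fps2_ord_pos:
  assumes "f \<noteq> 0" "coef f 0 0 = 0"
  shows "fps2_ord f > 0"
  using fps2_ord_attained[OF assms(1)] assms(2) by (metis add_is_0 gr0I)

lemma irreducible_fps2_ord_pos: "irreducible (f :: 'a::field fps2) \<Longrightarrow> fps2_ord f > 0"
  using fps2_ord_pos coef_0_0_irreducible irreducible_def by blast

text \<open>
The order of \<open>f(x, 0)\<close>, as a relation because the order is infinite for multiples of \<open>y\<close>.
\<close>

definition x_order :: "'a::field fps2 \<Rightarrow> nat \<Rightarrow> bool" where
  "x_order f k \<longleftrightarrow> coef f k 0 \<noteq> 0 \<and> (\<forall>i<k. coef f i 0 = 0)"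

text \<open>
If some monomial lay below the line through \<open>(k, 0)\<close> and \<open>(0, m)\<close>, where \<open>m\<close> is the order of \<open>f\<close>, then
so would a vertex of the Newton polygon, and it cannot lie on an axis: on the \<open>x\<close>-axis the exponents are
at least \<open>k\<close>, on the \<open>y\<close>-axis at least \<open>m\<close>.
\<close>

lemma irreducible_newton_polygon:
  fixes f :: "'a::field fps2"
  assumes irr: "irreducible f" and k: "x_order f k"
  shows "weight_ge (fps2_ord f) k (fps2_ord f * k) f"
proof (rule ccontr)
  define m where "m = fps2_ord f"
  assume "\<not> ?thesis"
  then obtain i j where ij: "coef f i j \<noteq> 0" "m * i + k * j < m * k"
    by (auto simp: weight_ge_def m_def not_le)
  have m: "m > 0"
    using irr by (simp add: m_def irreducible_fps2_ord_pos)
  have "k > 0"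
    using k coef_0_0_irreducible[OF irr] unfolding x_order_def by (metis gr0I)
  then obtain a b where lead: "leads m k f a b"
    using leads_exists ij(1) by (metis fps_zero_nth)
  have lt: "m * a + k * b < m * k"
  proof -
    have "m * a + k * b \<le> m * i + k * j"
      using lead ij(1) unfolding leads_def by (metis less_imp_le order_refl)
    with ij(2) show ?thesis
      by linarith
  qed
  have "coef f a b \<noteq> 0"
    using lead by (simp add: leads_def)
  have "b > 0"
  proof (rule ccontr)
    assume "\<not> b > 0"
    with \<open>coef f a b \<noteq> 0\<close> k have "\<not> a < k"
      by (auto simp: x_order_def)
    with lt have "m * a < m * a"
      by (metis add_lessD1 le_trans less_le_not_le mult_le_mono2 not_less)
    thus False by simp
  qed
  moreover have "a > 0"
  proof (rule ccontr)
    assume "\<not> a > 0"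
    with lt have "b < m"
      by (simp add: mult.commute)
    with \<open>coef f a b \<noteq> 0\<close> \<open>\<not> a > 0\<close> fps2_ord_le_coef[of f] show False
      by (force simp: m_def)
  qed
  \<comment> \<open>Several monomials may have the minimal weight for \<open>(m, k)\<close>. Tilting the weights slightly in favour of small \<open>x\<close>-exponents singles out the one with the largest \<open>y\<close>-exponent.\<close>
  moreover have "initial (m * Suc a + 1) (k * Suc a) f a b"
    unfolding initial_def
  proof (intro conjI allI impI)
    fix i j assume ij: "coef f i j \<noteq> 0"
    have eq: "(m * Suc a + 1) * i + (k * Suc a) * j = Suc a * (m * i + k * j) + i" for i j
      by (simp add: algebra_simps)
    consider "m * a + k * b < m * i + k * j" | "m * a + k * b = m * i + k * j" "j \<le> b"
      using lead ij by (auto simp: leads_def)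
    thus "(i, j) = (a, b) \<or>
        (m * Suc a + 1) * a + k * Suc a * b < (m * Suc a + 1) * i + k * Suc a * j"
    proof cases
      case 1
      hence "Suc a * Suc (m * a + k * b) \<le> Suc a * (m * i + k * j)"
        by (intro mult_le_mono2) simp
      thus ?thesis unfolding eq by simp
    next
      case 2
      show ?thesis
      proof (cases "j = b")
        case True
        with 2 m show ?thesis by simp
      next
        case False
        with 2(2) \<open>k > 0\<close> have "k * j < k * b" by simp
        with 2(1) have "m * a < m * i" by linarith
        hence "a < i" by simp
        thus ?thesis
          unfolding eq 2(1) by simp
      qed
    qed
  qed fact
  ultimately show False
    using reducible_if_mixed_initial irr by blast
qed

section \<open>Intersection numbers of irreducible series\<close>

abbreviation int_num :: "'a::field fps2 \<Rightarrow> 'a fps2 \<Rightarrow> enat" where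
  "int_num f g \<equiv> quotient_dim (ideal_gen {f, g})"

lemma int_num_commute: "int_num f g = int_num g f"
  by (simp add: insert_commute)

lemma int_num_cong_left:
  "ideal_gen {f} = ideal_gen {f'} \<Longrightarrow> int_num f g = int_num f' g"
  by (simp flip: intersection_number_ideal_gen)

lemma int_num_cong_right:
  "ideal_gen {g} = ideal_gen {g'} \<Longrightarrow> int_num f g = int_num f g'"
  by (simp flip: intersection_number_ideal_gen)

lemma enat_le_if_mult_le:
  assumes "enat (c * n) \<le> enat c * x" "c > 0"
  shows "enat n \<le> x"
  using assms by (cases x) auto

text \<open>
In this case the ideal is \<open>(f, 0)\<close>, and \<open>0\<close> has arbitrarily large weighted order.
\<close>

lemma int_num_eq_infinity_if_dvd:
  fixes f :: "'a::field fps2"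
  assumes f: "f \<noteq> 0" "coef f 0 0 = 0" and "f dvd g"
  shows "int_num f g = \<infinity>"
proof -
  obtain h where "g = f * h"
    using \<open>f dvd g\<close> by (elim dvdE)
  have eq: "ideal_gen {f, g} = ideal_gen {f, 0}"
  proof (intro set_eqI iffI)
    fix x assume "x \<in> ideal_gen {f, g}"
    then obtain u v where "x = f * u + g * v"
      by (auto simp: ideal_gen_pair)
    hence "x = f * (u + h * v) + 0 * 0"
      by (simp add: \<open>g = f * h\<close> algebra_simps)
    thus "x \<in> ideal_gen {f, 0}"
      unfolding ideal_gen_pair by blast
  next
    fix x assume "x \<in> ideal_gen {f, 0}"
    then obtain u where "x = f * u + g * 0"
      by (auto simp: ideal_gen_pair)
    thus "x \<in> ideal_gen {f, g}"
      unfolding ideal_gen_pair by blast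
  qed
  have "weight_ge 1 1 1 f"
    using f(2) by (auto simp: weight_ge_def) (metis One_nat_def Suc_leI add_is_0 gr0I)
  hence "enat n \<le> int_num f 0" for n
    using weight_bezout[OF f(1), where p = 1 and q = 1 and A = 1 and B = n and g = 0]
    by (simp add: one_enat_def[symmetric] del: One_nat_def)
  hence "int_num f 0 = \<infinity>"
    by (metis Suc_ile_eq enat.exhaust less_irrefl)
  thus ?thesis by (simp add: eq)
qed

lemma fps2_ord_eqI:
  assumes "coef f i j \<noteq> 0" "i + j = n" "weight_ge 1 1 n f"
  shows "fps2_ord f = n"
  using assms fps2_ord_le_coef[OF assms(1)] weight_ge_fps2_ord[of f n] by fastforce

lemma fps2_ord_X2: "fps2_ord X2 = 1"
  by (rule fps2_ord_eqI[where i = 1 and j = 0]) (auto simp: weight_ge_def split: if_splits)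

lemma fps2_ord_Y2: "fps2_ord Y2 = 1"
  by (rule fps2_ord_eqI[where i = 0 and j = 1]) (auto simp: weight_ge_def split: if_splits)

lemma ideal_gen_singleton_eq_iff: "ideal_gen {f} = ideal_gen {g} \<longleftrightarrow> f dvd g \<and> g dvd f"
  unfolding ideal_gen_singleton set_eq_iff mem_Collect_eq by (metis dvd_refl dvd_trans)

lemma fps2_ord_cong:
  assumes "f \<noteq> 0" "ideal_gen {f} = ideal_gen {g}"
  shows "fps2_ord f = fps2_ord g"
proof -
  have "g dvd f"
    using assms(2) by (simp add: ideal_gen_singleton_eq_iff)
  with assms(1) have "g \<noteq> 0" by auto
  show ?thesis
    using multiplicity_ideal_gen[OF assms(1)] multiplicity_ideal_gen[OF \<open>g \<noteq> 0\<close>]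
    unfolding assms(2) by simp
qed

lemma ideal_gen_eq_Y2:
  fixes f :: "'a::field fps2"
  assumes "irreducible f" "\<forall>i. coef f i 0 = 0"
  shows "ideal_gen {f} = ideal_gen {Y2}"
proof -
  have f: "f = Y2 * y_part 1 f"
    using assms(2) by (intro fps2_eqI) (use coef_Y2_power_mult[where b = 1 and f = "y_part 1 f"] in
      \<open>auto simp: y_part_def Suc_leI\<close>)
  have "\<not> Y2 dvd (1 :: 'a fps2)"
    by (simp add: unit_iff)
  hence "y_part 1 f dvd 1"
    using irreducibleD[OF assms(1) f] by blast
  then obtain v where "1 = y_part 1 f * v"
    by (elim dvdE)
  hence "Y2 = f * v"
    by (subst f) (simp add: mult.assoc)
  hence "f dvd Y2"
    by (rule dvdI)
  moreover have "Y2 dvd f"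
    by (subst f) simp
  ultimately show ?thesis
    by (simp add: ideal_gen_singleton_eq_iff)
qed

text \<open>
For a large weight of \<open>y\<close> the weighted order of \<open>f\<close> is governed by \<open>f(x, 0)\<close>.
\<close>

lemma le_int_num_Y2:
  fixes f :: "'a::field fps2"
  assumes "\<forall>i<k. coef f i 0 = 0"
  shows "enat k \<le> int_num f Y2"
proof -
  have "weight_ge 1 (Suc k) (Suc k) (Y2 :: 'a fps2)" "(Y2 :: 'a fps2) \<noteq> 0"
    by (auto simp: weight_ge_def Y2_def[symmetric] split: if_splits) (simp add: Y2_def)
  moreover have "weight_ge 1 (Suc k) k f"
  proof (rule weight_geI)
    fix i j assume "coef f i j \<noteq> 0"
    with assms show "k \<le> 1 * i + Suc k * j"
      by (cases j) (auto simp: not_less[symmetric])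
  qed
  ultimately have "enat (Suc k * k) \<le> enat (1 * Suc k) * int_num Y2 f"
    by (intro weight_bezout) auto
  thus ?thesis
    by (subst int_num_commute) (rule enat_le_if_mult_le[of "Suc k"], simp_all)
qed

lemma int_num_Y2:
  fixes f :: "'a::field fps2"
  assumes "x_order f k"
  shows "int_num f Y2 = enat k"
proof -
  have "initial 1 (Suc k) f k 0"
    unfolding initial_def
  proof (intro conjI allI impI)
    fix i j assume ij: "coef f i j \<noteq> 0"
    show "(i, j) = (k, 0) \<or> 1 * k + Suc k * 0 < 1 * i + Suc k * j"
      using ij assms by (cases "i = k"; cases j) (auto simp: x_order_def intro: linorder_neqE_nat)
  qed (use assms in \<open>simp add: x_order_def\<close>)
  moreover have "initial 1 (Suc k) (Y2 :: 'a fps2) 0 1"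
    by (simp add: initial_def)
  ultimately show ?thesis
    using quotient_dim_initial_powers by fastforce
qed

lemma x_order_cases:
  obtains "\<forall>i. coef f i 0 = 0" | k where "x_order f k"
proof (cases "\<forall>i. coef f i 0 = 0")
  case False
  hence "x_order f (LEAST i. coef f i 0 \<noteq> 0)"
    unfolding x_order_def by (metis (mono_tags, lifting) LeastI_ex not_less_Least)
  with that show thesis by blast
qed (use that in blast)

lemma int_num_Y2_infinity: "\<forall>i. coef f i 0 = 0 \<Longrightarrow> int_num f Y2 = \<infinity>"
  by (metis Suc_ile_eq enat.exhaust less_irrefl le_int_num_Y2)

text \<open>
If the Newton polygon lies on or above the line through \<open>(k, 0)\<close> and \<open>(0, m)\<close>, then weights \<open>P\<close>, \<open>Q\<close> with
\<open>Q / P > k / m\<close> attain their minimum on it only at \<open>(k, 0)\<close>; the next lemma treats \<open>(0, m)\<close> and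
\<open>Q / P < k / m\<close>.
\<close>

lemma initial_x:
  assumes k: "x_order f k" and w: "weight_ge m k (m * k) f" and slope: "P * k < Q * m" and P: "P > 0"
  shows "initial P Q f k 0"
  unfolding initial_def
proof (intro conjI allI impI)
  fix i j assume ij: "coef f i j \<noteq> 0"
  show "(i, j) = (k, 0) \<or> P * k + Q * 0 < P * i + Q * j"
  proof (cases "j = 0")
    case True
    with ij k have "\<not> i < k"
      by (auto simp: x_order_def)
    with True P show ?thesis by auto
  next
    case False
    have "m * k \<le> m * i + k * j"
      using w ij by (simp add: weight_ge_def)
    hence 1: "P * (m * k) \<le> P * (m * i + k * j)"
      by (rule mult_le_mono2)
    have 2: "P * k * j < Q * m * j"
      using slope False by simp
    have "m * (P * k) < m * (P * i + Q * j)"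
      using 1 2 by (simp only: distrib_left mult_ac)
    thus ?thesis by simp
  qed
qed (use k in \<open>simp add: x_order_def\<close>)

lemma initial_y:
  assumes m: "coef f 0 m \<noteq> 0" and w: "weight_ge m k (m * k) f" and slope: "Q * m < P * k" and Q: "Q > 0"
  shows "initial P Q f 0 m"
  unfolding initial_def
proof (intro conjI allI impI)
  fix i j assume ij: "coef f i j \<noteq> 0"
  have ge: "m * k \<le> m * i + k * j"
    using w ij by (simp add: weight_ge_def)
  show "(i, j) = (0, m) \<or> P * 0 + Q * m < P * i + Q * j"
  proof (cases "i = 0")
    case True
    have "k > 0" using slope by (cases k) auto
    with ge True have "m \<le> j" by simp
    with True Q show ?thesis by auto
  next
    case False
    have 1: "Q * (m * k) \<le> Q * (m * i + k * j)"
      using ge by (rule mult_le_mono2)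
    have 2: "Q * m * i < P * k * i"
      using slope False by simp
    have "k * (Q * m) < k * (P * i + Q * j)"
      using 1 2 by (simp only: distrib_left mult_ac)
    thus ?thesis by simp
  qed
qed (use m in simp)

text \<open>
If \<open>k\<close> exceeds the order \<open>m\<close> of \<open>f\<close>, then \<open>(0, m)\<close> is the only point with \<open>i + j = m\<close> on or above the
line through \<open>(k, 0)\<close> and \<open>(0, m)\<close>.
\<close>

lemma coef_y_power_ne_0:
  assumes f: "irreducible f" "x_order f k" and lt: "fps2_ord f < k"
  shows "coef f 0 (fps2_ord f) \<noteq> 0"
proof -
  have "f \<noteq> 0" using f(1) by auto
  then obtain i j where ij: "i + j = fps2_ord f" "coef f i j \<noteq> 0"
    using fps2_ord_attained by blast
  have "i = 0"
  proof (rule ccontr)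
    assume "i \<noteq> 0"
    hence "fps2_ord f * i < k * i" using lt by simp
    moreover have "fps2_ord f * k \<le> fps2_ord f * i + k * j"
      using irreducible_newton_polygon[OF f] ij(2) by (simp add: weight_ge_def)
    moreover have "fps2_ord f * k = k * i + k * j"
      by (metis ij(1) add_mult_distrib2 mult.commute)
    ultimately show False by linarith
  qed
  with ij show ?thesis by simp
qed

text \<open>
The hypothesis compares the slopes \<open>k / m(f) \<le> l / m(g)\<close>. With respect to the weights given by the
smaller slope, both series have the weighted orders of \<open>y\<^sup>m\<close> with \<open>m\<close> the respective multiplicity.
\<close>

lemma int_num_ge_min:
  fixes f g :: "'a::field fps2"
  assumes f: "irreducible f" "x_order f k" and g: "irreducible g" "x_order g l"
    and le: "k * fps2_ord g \<le> l * fps2_ord f"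
  shows "enat (k * fps2_ord g) \<le> int_num f g"
proof -
  define m n where "m = fps2_ord f" and "n = fps2_ord g"
  have pos: "m > 0" "n > 0" "k > 0"
    using f g irreducible_fps2_ord_pos coef_0_0_irreducible[OF f(1)]
    by (auto simp: m_def n_def x_order_def intro: gr0I)
  have "weight_ge m k (k * n) g"
  proof (rule weight_geI)
    fix i j assume "coef g i j \<noteq> 0"
    hence ge: "n * l \<le> n * i + l * j"
      using irreducible_newton_polygon[OF g] by (simp add: weight_ge_def n_def)
    show "k * n \<le> m * i + k * j"
    proof (cases "j \<ge> n")
      case True
      hence "k * n \<le> k * j" by simp
      thus ?thesis by linarith
    next
      case False
      then obtain d where n: "n = j + d"
        using le_Suc_ex[of j n] by auto
      have "l * d \<le> n * i"
        using ge by (simp add: n algebra_simps)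
      hence 1: "m * (l * d) \<le> m * (n * i)" by (rule mult_le_mono2)
      have 2: "k * n * d \<le> l * m * d"
        using le by (simp add: m_def n_def)
      have "n * (k * d) \<le> n * (m * i)"
        using 1 2 by (simp only: mult_ac)
      hence "k * d \<le> m * i"
        using pos by simp
      thus ?thesis
        by (simp add: n algebra_simps)
    qed
  qed
  moreover have "f \<noteq> 0" using f(1) by auto
  ultimately have "enat (m * k * (k * n)) \<le> enat (m * k) * int_num f g"
    using irreducible_newton_polygon[OF f] pos
    by (intro weight_bezout) (simp_all add: m_def)
  hence "enat (k * n) \<le> int_num f g"
    by (rule enat_le_if_mult_le) (use pos in simp)
  thus ?thesis by (simp add: n_def)
qed

text \<open>
For weights whose slope lies strictly between the two slopes, the initial forms of \<open>f\<close> and \<open>g\<close> are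
multiples of \<open>x\<^sup>k\<close> and of a power of \<open>y\<close>.
\<close>

lemma int_num_eq_min:
  fixes f g :: "'a::field fps2"
  assumes f: "irreducible f" "x_order f k" and g: "irreducible g" "x_order g l"
    and less: "k * fps2_ord g < l * fps2_ord f"
  shows "int_num f g = enat (k * fps2_ord g)"
proof -
  define m n where "m = fps2_ord f" and "n = fps2_ord g"
  have pos: "m > 0" "n > 0" "k > 0"
    using f g irreducible_fps2_ord_pos coef_0_0_irreducible[OF f(1)]
    by (auto simp: m_def n_def x_order_def intro: gr0I)
  have lt: "k * n < l * m"
    using less by (simp add: m_def n_def)
  have "m \<le> k"
    using fps2_ord_le_coef[where f = f and i = k and j = 0] f(2) by (simp add: m_def x_order_def)
  hence "m * n < m * l"
    using lt by (metis mult.commute mult_le_mono1 order_le_less_trans)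
  hence "n < l" by simp
  \<comment> \<open>the weights \<open>2 m n\<close> and \<open>k n + l m\<close> realize the mean of the slopes \<open>k / m\<close> and \<open>l / n\<close>\<close>
  have slopes: "2 * m * n * k < (k * n + l * m) * m" "(k * n + l * m) * n < 2 * m * n * l"
  proof -
    have "k * n * m < l * m * m" "k * n * n < l * m * n"
      using lt pos by simp_all
    thus "2 * m * n * k < (k * n + l * m) * m" "(k * n + l * m) * n < 2 * m * n * l"
      by (simp_all add: algebra_simps)
  qed
  have "initial (2 * m * n) (k * n + l * m) f k 0"
    using initial_x[OF f(2) irreducible_newton_polygon[OF f]] slopes(1) pos by (simp add: m_def)
  moreover have "initial (2 * m * n) (k * n + l * m) g 0 n"
    using initial_y[OF coef_y_power_ne_0[OF g] irreducible_newton_polygon[OF g]]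
      slopes(2) pos \<open>n < l\<close> by (simp add: n_def)
  ultimately have "int_num f g = enat (k * n)"
    by (rule quotient_dim_initial_powers) (use pos in simp_all)
  thus ?thesis by (simp add: n_def)
qed

lemma fps2_ord_le_int_num:
  fixes f g :: "'a::field fps2"
  assumes "f \<noteq> 0" "coef g 0 0 = 0"
  shows "enat (fps2_ord f) \<le> int_num f g"
proof -
  have "weight_ge 1 1 1 g"
    using assms(2) by (auto simp: weight_ge_def) (metis One_nat_def Suc_leI add_is_0 gr0I)
  moreover have "weight_ge 1 1 (fps2_ord f) f"
    using weight_ge_fps2_ord[OF assms(1)] by blast
  ultimately show ?thesis
    using weight_bezout[OF assms(1), where p = 1 and q = 1 and A = "fps2_ord f" and B = 1 and g = g]
    by (simp add: one_enat_def[symmetric] del: One_nat_def)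
qed

text \<open>
One of the two coordinate axes is transversal to an irreducible \<open>f\<close>, since by its Newton polygon the
initial form of \<open>f\<close> contains a pure power of \<open>x\<close> or of \<open>y\<close>. Together with \<open>fps2_ord_le_int_num\<close> this
describes the multiplicity by intersection numbers alone.
\<close>

lemma fps2_ord_eq_int_num:
  fixes f :: "'a::field fps2"
  assumes f: "irreducible f"
  obtains g where "coef g 0 0 = 0" "int_num f g = enat (fps2_ord f)"
proof -
  have X2: "int_num f X2 = enat (fps2_ord f)" if nz: "coef f 0 (fps2_ord f) \<noteq> 0"
  proof -
    define m where "m = fps2_ord f"
    have "initial (Suc m) 1 f 0 m"
      unfolding initial_def
    proof (intro conjI allI impI)
      fix i j assume ij: "coef f i j \<noteq> 0"
      show "(i, j) = (0, m) \<or> Suc m * 0 + 1 * m < Suc m * i + 1 * j"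
        using fps2_ord_le_coef[OF ij] by (cases i) (auto simp: m_def)
    qed (use nz in \<open>simp add: m_def\<close>)
    moreover have "initial (Suc m) 1 (X2 :: 'a fps2) 1 0"
      by (simp add: initial_def)
    ultimately have "int_num X2 f = enat (1 * m)"
      using quotient_dim_initial_powers by (metis zero_less_Suc zero_less_one)
    thus ?thesis
      by (simp add: m_def int_num_commute)
  qed
  show thesis
  proof (cases rule: x_order_cases[of f])
    case 1
    have "f \<noteq> 0" using f by auto
    have "int_num f X2 = int_num Y2 (X2 :: 'a fps2)" "fps2_ord f = 1"
      using fps2_ord_cong[OF \<open>f \<noteq> 0\<close> ideal_gen_eq_Y2[OF f 1]]
        int_num_cong_left[OF ideal_gen_eq_Y2[OF f 1], of X2] by (auto simp: fps2_ord_Y2)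
    moreover have "initial 1 1 (X2 :: 'a fps2) 1 0" "initial 1 1 (Y2 :: 'a fps2) 0 1"
      by (simp_all add: initial_def)
    hence "int_num X2 (Y2 :: 'a fps2) = enat (1 * 1)"
      by (rule quotient_dim_initial_powers) simp_all
    ultimately show thesis
      using that[of X2] by (simp add: int_num_commute)
  next
    case (2 k)
    show thesis
    proof (cases "fps2_ord f < k")
      case True
      with that[of X2] X2 coef_y_power_ne_0[OF f 2] show thesis by simp
    next
      case False
      with fps2_ord_le_coef[where f = f and i = k and j = 0] 2 have "fps2_ord f = k"
        by (simp add: x_order_def)
      with that[of Y2] int_num_Y2[OF 2] show thesis by simp
    qed
  qed
qed

text \<open>
Compare the order \<open>s\<close> of \<open>g(x, 0)\<close> with the slope \<open>k / m\<close> of \<open>f\<close>. If \<open>s < k / m\<close>, then for a slope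
in between the initial forms are powers of \<open>x\<close> and of \<open>y\<close> and \<open>(f, g) = s m\<close>, which is excluded.
Otherwise \<open>g\<close> has weighted order at least \<open>k\<close> for the weights \<open>(m, k)\<close>, so that \<open>(f, g) \<ge> k\<close>.
\<close>

lemma x_order_le_if_not_dvd:
  fixes f g :: "'a::field fps2"
  assumes f: "irreducible f" "x_order f k"
    and v: "int_num f g = enat v" "\<not> fps2_ord f dvd v"
  shows "k \<le> v"
proof -
  define m where "m = fps2_ord f"
  have m: "m > 0" "f \<noteq> 0"
    using f by (auto simp: m_def irreducible_fps2_ord_pos)
  have k: "k > 0"
    using f coef_0_0_irreducible[OF f(1)] by (auto simp: x_order_def intro: gr0I)
  have g0: "coef g 0 0 = 0"
  proof (rule ccontr)
    assume "coef g 0 0 \<noteq> 0"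
    hence "int_num f g = 0"
      by (intro quotient_dim_unit) (simp add: unit_iff)
    with v show False by (simp add: zero_enat_def)
  qed
  show ?thesis
  proof (cases "\<forall>i. m * i < k \<longrightarrow> coef g i 0 = 0")
    case True
    have "weight_ge m k k g"
    proof (rule weight_geI)
      fix i j assume ij: "coef g i j \<noteq> 0"
      show "k \<le> m * i + k * j"
        using True ij by (cases j) (auto simp: not_less[symmetric])
    qed
    with irreducible_newton_polygon[OF f] m k have "enat (m * k * k) \<le> enat (m * k) * int_num f g"
      by (intro weight_bezout) (simp_all add: m_def)
    hence "enat k \<le> int_num f g"
      by (rule enat_le_if_mult_le) (use m k in simp)
    with v show ?thesis by simp
  next
    case False
    then obtain i where i: "m * i < k" "coef g i 0 \<noteq> 0"
      by blast
    obtain s where s: "x_order g s"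
      using i(2) by (cases rule: x_order_cases[of g]) auto
    have "s \<le> i"
      using s i(2) by (auto simp: x_order_def not_less[symmetric])
    hence "m * s \<le> m * i" by simp
    with i(1) have lt: "m * s < k" by linarith
    have "s > 0"
      using s g0 by (auto simp: x_order_def intro: gr0I)
    with lt have "m < k"
      by (metis le_less_trans mult.right_neutral mult_le_mono2 One_nat_def Suc_leI)
    have "initial (2 * m) (m * s + k) f 0 m"
      using initial_y[OF coef_y_power_ne_0[OF f] irreducible_newton_polygon[OF f],
          of "m * s + k" "2 * m"] \<open>m < k\<close> lt m by (simp add: m_def algebra_simps)
    moreover have "initial (2 * m) (m * s + k) g s 0"
      unfolding initial_def
    proof (intro conjI allI impI)
      fix i j assume ij: "coef g i j \<noteq> 0"
      show "(i, j) = (s, 0) \<or> 2 * m * s + (m * s + k) * 0 < 2 * m * i + (m * s + k) * j"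
      proof (cases "j = 0")
        case True
        with ij s have "\<not> i < s" by (auto simp: x_order_def)
        with True m show ?thesis by auto
      next
        case False
        hence "m * s + k \<le> (m * s + k) * j" by simp
        moreover have "2 * m * s < m * s + k" using lt by simp
        ultimately show ?thesis by linarith
      qed
    qed (use s in \<open>simp add: x_order_def\<close>)
    ultimately have "int_num g f = enat (s * m)"
      using quotient_dim_initial_powers m(1) k by (metis add_pos_nonneg mult_pos_pos pos2 zero_le add.commute)
    with v show ?thesis
      by (simp add: int_num_commute m_def)
  qed
qed

section \<open>Changes of coordinates\<close>

text \<open>
Automorphisms of the \<open>K\<close>-algebra of power series. They preserve intersection numbers; the multiplicity
of an irreducible series is preserved because it is determined by intersection numbers.
\<close>

locale fps2_automorphism =
  fixes \<sigma> :: "'a::field fps2 \<Rightarrow> 'a fps2"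
  assumes bij: "bij \<sigma>"
    and add: "\<sigma> (f + g) = \<sigma> f + \<sigma> g"
    and mult: "\<sigma> (f * g) = \<sigma> f * \<sigma> g"
    and scale: "\<sigma> (scale_fps2 c f) = scale_fps2 c (\<sigma> f)"
begin

lemma eq_iff: "\<sigma> f = \<sigma> g \<longleftrightarrow> f = g"
  using bij by (simp add: bij_def inj_eq)

lemma zero: "\<sigma> 0 = 0"
proof -
  have "\<sigma> 0 + \<sigma> 0 = \<sigma> 0 + 0"
    by (simp only: add[symmetric] add_0_right)
  thus ?thesis by (rule add_left_imp_eq)
qed

lemma one: "\<sigma> 1 = 1"
proof -
  have "\<sigma> 1 \<noteq> \<sigma> 0" by (simp add: eq_iff)
  thus ?thesis
    using mult[of 1 1] zero by simp
qed

lemma diff: "\<sigma> (f - g) = \<sigma> f - \<sigma> g"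
  using add[of "f - g" g] by simp

lemma sum: "\<sigma> (sum h S) = (\<Sum>s\<in>S. \<sigma> (h s))"
  by (induction S rule: infinite_finite_induct) (simp_all add: zero add)

lemma surj_obtain:
  obtains g where "f = \<sigma> g"
  using bij by (meson bij_pointE)

lemma dvd_iff: "\<sigma> f dvd \<sigma> g \<longleftrightarrow> f dvd g"
proof
  assume "\<sigma> f dvd \<sigma> g"
  then obtain h where "\<sigma> g = \<sigma> f * h" by (elim dvdE)
  moreover obtain h' where "h = \<sigma> h'" by (rule surj_obtain)
  ultimately show "f dvd g"
    by (simp add: mult[symmetric] eq_iff)
qed (auto simp: mult)

lemma unit_iff_unit: "\<sigma> f dvd 1 \<longleftrightarrow> f dvd 1"
  using dvd_iff[of f 1] by (simp add: one)

lemma coef_0_0_iff: "coef (\<sigma> f) 0 0 = 0 \<longleftrightarrow> coef f 0 0 = 0"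
  using unit_iff_unit unit_iff by blast

lemma irreducible_iff: "irreducible (\<sigma> f) \<longleftrightarrow> irreducible f"
proof -
  have "(\<forall>a b. \<sigma> f = a * b \<longrightarrow> a dvd 1 \<or> b dvd 1) \<longleftrightarrow> (\<forall>a b. f = a * b \<longrightarrow> a dvd 1 \<or> b dvd 1)"
  proof (intro iffI allI impI)
    fix a b assume "\<forall>a b. \<sigma> f = a * b \<longrightarrow> a dvd 1 \<or> b dvd 1" "f = a * b"
    thus "a dvd 1 \<or> b dvd 1"
      using mult[of a b] unit_iff_unit by blast
  next
    fix a b assume *: "\<forall>a b. f = a * b \<longrightarrow> a dvd 1 \<or> b dvd 1" "\<sigma> f = a * b"
    obtain a' where a': "a = \<sigma> a'" by (rule surj_obtain)
    obtain b' where b': "b = \<sigma> b'" by (rule surj_obtain)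
    have "f = a' * b'"
      using *(2) by (simp add: a' b' mult[symmetric] eq_iff)
    with *(1) show "a dvd 1 \<or> b dvd 1"
      by (simp add: a' b' unit_iff_unit)
  qed
  moreover have "\<sigma> f = 0 \<longleftrightarrow> f = 0"
    using eq_iff[of f 0] by (simp add: zero)
  ultimately show ?thesis
    by (simp add: irreducible_def unit_iff_unit)
qed

lemma ideal_gen_eq_iff: "ideal_gen {\<sigma> f} = ideal_gen {\<sigma> g} \<longleftrightarrow> ideal_gen {f} = ideal_gen {g}"
  by (simp add: ideal_gen_singleton_eq_iff dvd_iff)

lemma inverse: "fps2_automorphism (inv \<sigma>)"
proof
  have inv: "\<sigma> (inv \<sigma> f) = f" for f
    using bij by (simp add: bij_def surj_f_inv_f)
  show "bij (inv \<sigma>)"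
    using bij by (rule bij_imp_bij_inv)
  show "inv \<sigma> (f + g) = inv \<sigma> f + inv \<sigma> g" for f g
    by (subst eq_iff[symmetric]) (simp add: inv add)
  show "inv \<sigma> (f * g) = inv \<sigma> f * inv \<sigma> g" for f g
    by (subst eq_iff[symmetric]) (simp add: inv mult)
  show "inv \<sigma> (scale_fps2 c f) = scale_fps2 c (inv \<sigma> f)" for c f
    by (subst eq_iff[symmetric]) (simp add: inv scale)
qed

lemma int_num_le: "int_num f g \<le> int_num (\<sigma> f) (\<sigma> g)"
  unfolding quotient_dim_def[of "ideal_gen {f, g}"]
proof (rule SUP_least)
  fix S assume S: "S \<in> {S. finite S \<and> independent_mod (ideal_gen {f, g}) S}"
  have inj: "inj_on \<sigma> S"
    by (rule inj_onI) (simp add: eq_iff)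
  have "independent_mod (ideal_gen {\<sigma> f, \<sigma> g}) (\<sigma> ` S)"
    unfolding independent_mod_def
  proof (intro allI impI)
    fix c assume "(\<Sum>s\<in>\<sigma> ` S. scale_fps2 (c s) s) \<in> ideal_gen {\<sigma> f, \<sigma> g}"
    also have "(\<Sum>s\<in>\<sigma> ` S. scale_fps2 (c s) s) = \<sigma> (\<Sum>s\<in>S. scale_fps2 (c (\<sigma> s)) s)"
      by (simp add: sum.reindex[OF inj] sum scale)
    finally obtain u v where "\<sigma> (\<Sum>s\<in>S. scale_fps2 (c (\<sigma> s)) s) = \<sigma> f * u + \<sigma> g * v"
      by (auto simp: ideal_gen_pair)
    moreover obtain u' v' where "u = \<sigma> u'" "v = \<sigma> v'"
      by (metis surj_obtain)
    ultimately have "(\<Sum>s\<in>S. scale_fps2 (c (\<sigma> s)) s) = f * u' + g * v'"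
      by (simp add: add[symmetric] mult[symmetric] eq_iff)
    hence "(\<Sum>s\<in>S. scale_fps2 (c (\<sigma> s)) s) \<in> ideal_gen {f, g}"
      unfolding ideal_gen_pair by blast
    moreover have "independent_mod (ideal_gen {f, g}) S"
      using S by simp
    ultimately have "\<forall>s\<in>S. c (\<sigma> s) = 0"
      unfolding independent_mod_def by (elim allE[of _ "\<lambda>s. c (\<sigma> s)"]) simp
    thus "\<forall>s\<in>\<sigma> ` S. c s = 0"
      by simp
  qed
  hence "enat (card (\<sigma> ` S)) \<le> int_num (\<sigma> f) (\<sigma> g)"
    unfolding quotient_dim_def using S by (intro SUP_upper) simp
  thus "enat (card S) \<le> int_num (\<sigma> f) (\<sigma> g)"
    by (simp add: card_image[OF inj])
qed

lemma int_num_eq: "int_num (\<sigma> f) (\<sigma> g) = int_num f g"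
proof (rule antisym)
  have "inv \<sigma> (\<sigma> h) = h" for h
    using bij by (simp add: bij_def)
  thus "int_num (\<sigma> f) (\<sigma> g) \<le> int_num f g"
    using fps2_automorphism.int_num_le[OF inverse, of "\<sigma> f" "\<sigma> g"] by simp
qed (rule int_num_le)

lemma fps2_ord_eq:
  assumes "irreducible f"
  shows "fps2_ord (\<sigma> f) = fps2_ord f"
proof (rule antisym)
  have nz: "f \<noteq> 0" "\<sigma> f \<noteq> 0"
    using assms irreducible_iff[of f] by auto
  obtain g where "coef g 0 0 = 0" "int_num f g = enat (fps2_ord f)"
    using fps2_ord_eq_int_num[OF assms] .
  thus "fps2_ord (\<sigma> f) \<le> fps2_ord f"
    using fps2_ord_le_int_num[OF nz(2), of "\<sigma> g"] by (simp add: coef_0_0_iff int_num_eq)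
  have "irreducible (\<sigma> f)"
    using assms by (simp add: irreducible_iff)
  then obtain h where h: "coef h 0 0 = 0" "int_num (\<sigma> f) h = enat (fps2_ord (\<sigma> f))"
    by (rule fps2_ord_eq_int_num)
  obtain h' where "h = \<sigma> h'" by (rule surj_obtain)
  with h show "fps2_ord f \<le> fps2_ord (\<sigma> f)"
    using fps2_ord_le_int_num[OF nz(1), of h'] by (simp add: coef_0_0_iff int_num_eq)
qed

end

lemma fps2_automorphism_comp:
  assumes "fps2_automorphism \<sigma>" "fps2_automorphism \<tau>"
  shows "fps2_automorphism (\<sigma> \<circ> \<tau>)"
  using assms unfolding fps2_automorphism_def by (simp add: bij_comp)

definition swap_vars :: "'a::field fps2 \<Rightarrow> 'a fps2" where
  "swap_vars f = of_coefs (\<lambda>i j. coef f j i)"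

lemma coef_swap_vars [simp]: "coef (swap_vars f) i j = coef f j i"
  by (simp add: swap_vars_def)

lemma swap_swap_vars [simp]: "swap_vars (swap_vars f) = f"
  by (rule fps2_eqI) simp

lemma fps2_automorphism_swap: "fps2_automorphism swap_vars"
proof
  show "bij swap_vars"
    by (rule bij_betw_byWitness[where f' = swap_vars]) auto
  show "swap_vars (f * g) = swap_vars f * swap_vars g" for f g :: "'a fps2"
  proof (rule fps2_eqI)
    fix i j
    have "coef (swap_vars (f * g)) i j = (\<Sum>k=0..i. \<Sum>l=0..j. coef f l k * coef g (j - l) (i - k))"
      unfolding coef_swap_vars coef_mult ..
    also have "\<dots> = (\<Sum>l=0..j. \<Sum>k=0..i. coef f l k * coef g (j - l) (i - k))"
      by (rule sum.swap)
    also have "\<dots> = coef (swap_vars f * swap_vars g) i j"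
      unfolding coef_swap_vars coef_mult ..
    finally show "coef (swap_vars (f * g)) i j = coef (swap_vars f * swap_vars g) i j" .
  qed
qed (rule fps2_eqI, simp)+

text \<open>
The series \<open>f(x, w)\<close>. For \<open>w\<close> without constant term the power \<open>w\<^sup>l\<close> has order at least \<open>l\<close>, hence the
coefficient of \<open>x\<^sup>i y\<^sup>j\<close> needs only the terms with \<open>l \<le> i + j\<close>. The series \<open>w\<close> may contain pure powers
of \<open>x\<close>, so this is more general than the composition of series in \<open>y\<close> over \<open>K[[x]]\<close>.
\<close>

definition subst_y :: "'a::field fps2 \<Rightarrow> 'a fps2 \<Rightarrow> 'a fps2" where
  "subst_y w f = of_coefs (\<lambda>i j. \<Sum>l\<le>i+j. coef (fps_const (f $ l) * w ^ l) i j)"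

definition subst_y_upto :: "nat \<Rightarrow> 'a::field fps2 \<Rightarrow> 'a fps2 \<Rightarrow> 'a fps2" where
  "subst_y_upto n w f = (\<Sum>l\<le>n. fps_const (f $ l) * w ^ l)"

lemma weight_ge_nonunit: "coef f 0 0 = 0 \<Longrightarrow> weight_ge 1 1 1 f"
  by (auto simp: weight_ge_def) (metis One_nat_def Suc_leI add_is_0 gr0I)

lemma weight_ge_1_1_power:
  assumes "coef w 0 0 = 0"
  shows "weight_ge 1 1 l (f * w ^ l)"
  using weight_ge_mult_right[OF weight_ge_power[OF weight_ge_nonunit[OF assms], of l]] by simp

lemma subst_y_approx:
  assumes w: "coef w 0 0 = 0"
  shows "weight_ge 1 1 (Suc n) (subst_y w f - subst_y_upto n w f)"
proof (rule weight_geI, rule ccontr)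
  fix i j assume nz: "coef (subst_y w f - subst_y_upto n w f) i j \<noteq> 0" and "\<not> Suc n \<le> 1 * i + 1 * j"
  hence le: "i + j \<le> n" by simp
  have "coef (subst_y_upto n w f) i j = (\<Sum>l\<le>n. coef (fps_const (f $ l) * w ^ l) i j)"
    by (simp add: subst_y_upto_def fps_sum_nth)
  also have "\<dots> = (\<Sum>l\<le>i+j. coef (fps_const (f $ l) * w ^ l) i j)"
  proof (rule sum.mono_neutral_right)
    show "\<forall>l\<in>{..n} - {..i + j}. coef (fps_const (f $ l) * w ^ l) i j = 0"
      by (intro ballI weight_geD[OF weight_ge_1_1_power[OF w]]) auto
  qed (use le in auto)
  also have "\<dots> = coef (subst_y w f) i j"
    by (simp add: subst_y_def)
  finally show False
    using nz by simp
qed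

lemma subst_y_upto_mult:
  assumes w: "coef w 0 0 = 0"
  shows "weight_ge 1 1 (Suc n)
           (subst_y_upto n w f * subst_y_upto n w g - subst_y_upto n w (f * g))"
proof -
  define t where "t a b = fps_const (f $ a) * w ^ a * (fps_const (g $ b) * w ^ b)" for a b
  have t: "t a b = fps_const (f $ a * g $ b) * w ^ (a + b)" for a b
    by (simp add: t_def power_add mult_ac flip: fps_const_mult)
  define T where "T = {(a, b). a + b \<le> n}"
  have fin: "finite T"
    by (rule finite_subset[of _ "{..n} \<times> {..n}"]) (auto simp: T_def)
  have "subst_y_upto n w f * subst_y_upto n w g = (\<Sum>a\<le>n. \<Sum>b\<le>n. t a b)"
    by (simp add: subst_y_upto_def sum_product t_def)
  also have "\<dots> = (\<Sum>(a, b)\<in>{..n} \<times> {..n}. t a b)"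
    by (simp add: sum.cartesian_product)
  also have "\<dots> = (\<Sum>(a, b)\<in>{..n} \<times> {..n} - T. t a b) + (\<Sum>(a, b)\<in>T. t a b)"
    by (rule sum.subset_diff) (auto simp: T_def)
  also have "(\<Sum>(a, b)\<in>T. t a b) = (\<Sum>l\<le>n. \<Sum>a\<le>l. t a (l - a))"
    unfolding T_def by (rule sum.triangle_reindex_eq)
  also have "\<dots> = subst_y_upto n w (f * g)"
    unfolding subst_y_upto_def
  proof (intro sum.cong refl)
    fix l
    have "(\<Sum>a\<le>l. t a (l - a)) = (\<Sum>a=0..l. fps_const (f $ a * g $ (l - a)) * w ^ l)"
      by (intro sum.cong) (auto simp: t)
    also have "\<dots> = fps_const ((f * g) $ l) * w ^ l"
    proof -
      have "fps_const ((f * g) $ l) = (\<Sum>a=0..l. fps_const (f $ a * g $ (l - a)))"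
        by (rule fps_ext) (simp add: fps_mult_nth fps_sum_nth)
      thus ?thesis by (simp add: sum_distrib_right)
    qed
    finally show "(\<Sum>a\<le>l. t a (l - a)) = fps_const ((f * g) $ l) * w ^ l" .
  qed
  finally have "subst_y_upto n w f * subst_y_upto n w g - subst_y_upto n w (f * g) =
      (\<Sum>(a, b)\<in>{..n} \<times> {..n} - T. t a b)"
    by simp
  moreover have "weight_ge 1 1 (Suc n) (t a b)" if "(a, b) \<notin> T" for a b
    unfolding t using that weight_ge_mono[OF weight_ge_1_1_power[OF w]] by (auto simp: T_def)
  ultimately show ?thesis
    by (auto intro!: weight_ge_sum)
qed

lemma subst_y_mult:
  assumes w: "coef w 0 0 = 0"
  shows "subst_y w (f * g) = subst_y w f * subst_y w g"
proof -
  have "subst_y w f * subst_y w g - subst_y w (f * g) = 0"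
  proof (rule eq_0_if_weight_ge_all)
    fix n
    let ?S = "subst_y w" and ?P = "subst_y_upto n w"
    have 1: "weight_ge 1 1 (Suc n) ((?S g - ?P g) * ?S f)"
      using weight_ge_mult_right[OF subst_y_approx[OF w, of n g]] by (simp add: mult.commute)
    have 2: "weight_ge 1 1 (Suc n) (?P g * (?S f - ?P f))"
      by (rule weight_ge_mult_right[OF subst_y_approx[OF w]])
    have eq: "?S f * ?S g - ?S (f * g) = (?S g - ?P g) * ?S f + ?P g * (?S f - ?P f)
        + (?P f * ?P g - ?P (f * g)) - (?S (f * g) - ?P (f * g))"
      by (simp add: algebra_simps)
    have "weight_ge 1 1 (Suc n) (?S f * ?S g - ?S (f * g))"
      unfolding eq by (intro weight_ge_diff[OF weight_ge_add[OF weight_ge_add]] 1 2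
        subst_y_upto_mult[OF w] subst_y_approx[OF w])
    thus "weight_ge 1 1 n (?S f * ?S g - ?S (f * g))"
      by (rule weight_ge_mono) simp
  qed
  thus ?thesis by simp
qed

lemma subst_y_add: "subst_y w (f + g) = subst_y w f + subst_y w g"
  by (rule fps2_eqI) (simp add: subst_y_def distrib_right sum.distrib)

lemma subst_y_const: "subst_y w (fps_const a) = fps_const a"
proof (rule fps2_eqI)
  fix i j
  have "coef (subst_y w (fps_const a)) i j = (\<Sum>l\<le>i+j. if l = 0 then coef (fps_const a) i j else 0)"
    unfolding subst_y_def coef_of_coefs by (intro sum.cong refl) auto
  thus "coef (subst_y w (fps_const a)) i j = coef (fps_const a) i j"
    by simp
qed

lemma subst_y_Y2:
  assumes "coef w 0 0 = 0"
  shows "subst_y w Y2 = w"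
proof (rule fps2_eqI)
  fix i j
  have "coef (subst_y w Y2) i j = (\<Sum>l\<le>i+j. if l = 1 then coef w i j else 0)"
    unfolding subst_y_def coef_of_coefs by (intro sum.cong refl) (auto simp: Y2_def fps_X_def)
  thus "coef (subst_y w Y2) i j = coef w i j"
    using assms by (cases "i + j = 0") auto
qed

text \<open>
For the weights \<open>2\<close> and \<open>1\<close> all monomials except \<open>1\<close> and \<open>y\<close> have weight at least \<open>2\<close>. So the
substitution \<open>y \<mapsto> w\<close>, for every \<open>w\<close> in the maximal ideal with coefficient \<open>1\<close> at \<open>y\<close>, is the identity
up to terms of larger weight, even if \<open>w\<close> contains a multiple of \<open>x\<close>.
\<close>

lemma subst_y_near_id:
  fixes w :: "'a::field fps2"
  assumes w: "weight_ge 2 1 2 (w - Y2)" and f: "weight_ge 2 1 N f"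
  shows "weight_ge 2 1 (Suc N) (f - subst_y w f)"
proof -
  have Y1: "weight_ge 2 1 1 (Y2 :: 'a fps2)"
    by (auto simp: weight_ge_def split: if_splits)
  have w1: "weight_ge 2 1 1 w"
    using weight_ge_add[OF weight_ge_mono[OF w, of 1] Y1] by simp
  have pow: "weight_ge 2 1 (Suc l) (Y2 ^ l - w ^ l)" for l
  proof (induction l)
    case (Suc l)
    have "weight_ge 2 1 (1 + Suc l) (Y2 * (Y2 ^ l - w ^ l))"
      by (rule weight_ge_mult[OF Y1 Suc])
    moreover have "weight_ge 2 1 (2 + l * 1) ((w - Y2) * w ^ l)"
      by (rule weight_ge_mult[OF w weight_ge_power[OF w1]])
    ultimately have "weight_ge 2 1 (Suc (Suc l)) (Y2 * (Y2 ^ l - w ^ l) - (w - Y2) * w ^ l)"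
      by (intro weight_ge_diff) simp_all
    thus ?case by (simp add: algebra_simps)
  qed simp
  have summand: "weight_ge 2 1 (Suc N) (fps_const (f $ l) * (Y2 ^ l - w ^ l))" for l
  proof -
    have "weight_ge 2 1 (N - l) (fps_const (f $ l))"
      using f by (force simp: weight_ge_def split: if_splits)
    from weight_ge_mult[OF this pow[of l]] show ?thesis
      by (rule weight_ge_mono) simp
  qed
  show ?thesis
  proof (rule weight_geI, rule ccontr)
    fix i j assume nz: "coef (f - subst_y w f) i j \<noteq> 0" and "\<not> Suc N \<le> 2 * i + 1 * j"
    hence "coef (\<Sum>l\<le>i+j. fps_const (f $ l) * (Y2 ^ l - w ^ l)) i j = 0"
      by (intro weight_geD[OF weight_ge_sum[OF summand]]) simp
    moreover have "coef f i j = (\<Sum>l\<le>i+j. coef (fps_const (f $ l) * Y2 ^ l) i j)"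
    proof -
      have "(\<Sum>l\<le>i+j. coef (fps_const (f $ l) * Y2 ^ l) i j) = (\<Sum>l\<le>i+j. if l = j then coef f i j else 0)"
        by (intro sum.cong refl) (auto simp: Y2_def fps_X_power_nth)
      thus ?thesis by simp
    qed
    ultimately show False
      using nz by (simp add: subst_y_def fps_sum_nth right_diff_distrib sum_subtractf)
  qed
qed

text \<open>
Since the difference to the identity raises weights, the substitution is bijective: \<open>subst_y w z = h\<close>
is the fixed-point equation \<open>z = h + (z - subst_y w z)\<close>.
\<close>

lemma fps2_automorphism_subst_y:
  fixes w :: "'a::field fps2"
  assumes w: "weight_ge 2 1 2 (w - Y2)"
  shows "fps2_automorphism (subst_y w)"
proof
  have w0: "coef w 0 0 = 0"
    using weight_geD[OF w, of 0 0] by simp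
  show add: "subst_y w (f + g) = subst_y w f + subst_y w g" for f g
    by (rule subst_y_add)
  hence diff: "subst_y w (f - g) = subst_y w f - subst_y w g" for f g
    by (metis add_diff_cancel_right' diff_add_cancel)
  show mult: "subst_y w (f * g) = subst_y w f * subst_y w g" for f g
    by (rule subst_y_mult[OF w0])
  show "subst_y w (scale_fps2 c f) = scale_fps2 c (subst_y w f)" for c f
    by (simp add: scale_fps2_def mult subst_y_const)
  have "inj (subst_y w)"
  proof (rule injI)
    fix f g assume "subst_y w f = subst_y w g"
    hence eq: "(f - g) - subst_y w (f - g) = f - g"
      by (simp add: diff)
    have "weight_ge 2 1 N (f - g)" for N
    proof (induction N)
      case (Suc N)
      from subst_y_near_id[OF w Suc] show ?case unfolding eq .
    qed simp
    hence "f - g = 0" by (rule eq_0_if_weight_ge_all)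
    thus "f = g" by simp
  qed
  moreover have "\<exists>z. h = subst_y w z" for h
  proof -
    obtain z where "h + (z - subst_y w z) = z"
    proof (rule contraction_fixpoint[of 2 1 0 "\<lambda>z. h + (z - subst_y w z)"])
      fix z z' :: "'a fps2" and N assume "weight_ge 2 1 N (z - z')"
      from subst_y_near_id[OF w this]
      show "weight_ge 2 1 (Suc N) (h + (z - subst_y w z) - (h + (z' - subst_y w z')))"
        by (simp add: diff algebra_simps)
    qed auto
    hence "h = subst_y w z" by (simp add: algebra_simps)
    thus ?thesis ..
  qed
  ultimately show "bij (subst_y w)"
    by (auto simp: bij_def surj_def)
qed

section \<open>Smooth branches\<close>

lemma irreducible_if_fps2_ord_1:
  fixes w :: "'a::field fps2"
  assumes "fps2_ord w = 1" "w \<noteq> 0"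
  shows "irreducible w"
proof (rule irreducibleI)
  have "weight_ge 1 1 1 w"
    using weight_ge_fps2_ord[OF assms(2), of 1] assms(1) by simp
  hence "coef w 0 0 = 0"
    by (rule weight_geD) simp
  thus "\<not> w dvd 1"
    by (simp add: unit_iff)
  fix a b assume w: "w = a * b"
  show "a dvd 1 \<or> b dvd 1"
  proof (rule ccontr)
    assume "\<not> ?thesis"
    hence "weight_ge 1 1 1 a" "weight_ge 1 1 1 b"
      using weight_ge_nonunit[of a] weight_ge_nonunit[of b] by (simp_all add: unit_iff)
    hence "weight_ge 1 1 (1 + 1) w"
      unfolding w by (rule weight_ge_mult)
    hence "1 + 1 \<le> fps2_ord w"
      using weight_ge_fps2_ord[OF assms(2)] by blast
    thus False
      using assms(1) by simp
  qed
qed (rule assms)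

definition smooth :: "'a::field fps2 \<Rightarrow> bool" where
  "smooth w \<longleftrightarrow> w \<noteq> 0 \<and> fps2_ord w = 1"

lemma irreducible_smooth: "smooth w \<Longrightarrow> irreducible w"
  by (simp add: smooth_def irreducible_if_fps2_ord_1)

lemma smooth_Y2: "smooth Y2"
  by (simp add: smooth_def fps2_ord_Y2) (simp add: Y2_def)

lemma (in fps2_automorphism) smooth: "smooth w \<Longrightarrow> smooth (\<sigma> w)"
  using irreducible_smooth[of w] irreducible_iff[of w] by (auto simp: smooth_def fps2_ord_eq)

lemma smooth_straighten_y:
  assumes w: "coef w 0 0 = 0" "coef w 0 1 \<noteq> 0"
  obtains \<sigma> where "fps2_automorphism \<sigma>" "ideal_gen {w} = ideal_gen {\<sigma> Y2}"
proof -
  define c w' where "c = coef w 0 1" and "w' = scale_fps2 (1 / c) w"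
  have c: "c \<noteq> 0" using w by (simp add: c_def)
  have "w = scale_fps2 c w'"
    using c by (simp add: w'_def)
  hence "w' dvd w" "w dvd w'"
    unfolding w'_def scale_fps2_def by (metis dvd_triv_right)+
  hence "ideal_gen {w} = ideal_gen {w'}"
    by (simp add: ideal_gen_singleton_eq_iff)
  moreover have "weight_ge 2 1 2 (w' - Y2)"
  proof (rule weight_geI)
    fix i j assume nz: "coef (w' - Y2) i j \<noteq> 0"
    have "(i, j) \<noteq> (0, 0)" "(i, j) \<noteq> (0, 1)"
      using nz w c by (auto simp: w'_def c_def intro!: gr0I)
    thus "2 \<le> 2 * i + 1 * j"
      by (cases i) auto
  qed
  moreover have "coef w' 0 0 = 0"
    using w by (simp add: w'_def)
  ultimately show thesis
    using that[of "subst_y w'"] fps2_automorphism_subst_y subst_y_Y2 by metis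
qed

text \<open>
A smooth branch is an axis of suitable coordinates. If its tangent is not the line \<open>x = 0\<close>, its equation
can replace \<open>y\<close>; otherwise \<open>x\<close> and \<open>y\<close> are exchanged first.
\<close>

lemma smooth_straighten:
  assumes "smooth w"
  obtains \<sigma> where "fps2_automorphism \<sigma>" "ideal_gen {w} = ideal_gen {\<sigma> Y2}"
proof (cases "coef w 0 1 = 0")
  case False
  with assms show thesis
    using smooth_straighten_y[OF coef_0_0_irreducible[OF irreducible_smooth]] that by blast
next
  case True
  interpret swap: fps2_automorphism "swap_vars :: 'a fps2 \<Rightarrow> 'a fps2"
    by (rule fps2_automorphism_swap)
  obtain i j where "i + j = 1" "coef w i j \<noteq> 0"
    using assms fps2_ord_attained[of w] by (auto simp: smooth_def)
  with True have "coef w 1 0 \<noteq> 0"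
    by (cases i) auto
  moreover have "coef w 0 0 = 0"
    by (rule coef_0_0_irreducible[OF irreducible_smooth[OF assms]])
  ultimately obtain \<sigma> where \<sigma>: "fps2_automorphism \<sigma>" "ideal_gen {swap_vars w} = ideal_gen {\<sigma> Y2}"
    using smooth_straighten_y[of "swap_vars w"] by auto
  hence "ideal_gen {w} = ideal_gen {swap_vars (\<sigma> Y2)}"
    using swap.ideal_gen_eq_iff[of "swap_vars w" "\<sigma> Y2"] by simp
  with that[of "swap_vars \<circ> \<sigma>"] fps2_automorphism_comp[OF fps2_automorphism_swap \<sigma>(1)]
  show thesis by simp
qed

text \<open>
If \<open>k = m q\<close>, where \<open>m\<close> is the order of \<open>f\<close>, then the part of \<open>f\<close> on the line through \<open>(k, 0)\<close> and
\<open>(0, m)\<close> is a form of degree \<open>m\<close> in \<open>x\<^sup>q\<close> and \<open>y\<close>. Let \<open>y\<^sup>m\<close> occur in it. Then it vanishes at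
\<open>y = c x\<^sup>q\<close> for some \<open>c\<close> in \<open>K\<close>, so \<open>f(x, c x\<^sup>q)\<close> has order larger than \<open>k\<close>, and this order is the
intersection number with \<open>y - c x\<^sup>q\<close>. If \<open>y\<^sup>m\<close> does not occur, then \<open>f\<close> is tangent to the other axis,
which then serves as the smooth branch.
\<close>

lemma smooth_increase_contact_y:
  fixes f :: "'a::alg_closed_field fps2"
  assumes f: "irreducible f" "x_order f k" and dvd: "fps2_ord f dvd k"
  obtains w where "smooth w" "enat k < int_num f w"
proof -
  define m where "m = fps2_ord f"
  have m: "m > 0"
    using f by (simp add: m_def irreducible_fps2_ord_pos)
  obtain q where k: "k = m * q"
    using dvd by (auto simp: m_def)
  have "k > 0"
    using f coef_0_0_irreducible[OF f(1)] by (auto simp: x_order_def intro: gr0I)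
  hence q: "q > 0" by (simp add: k)
  show thesis
  proof (cases "coef f 0 m = 0")
    case True
    interpret swap: fps2_automorphism "swap_vars :: 'a fps2 \<Rightarrow> 'a fps2"
      by (rule fps2_automorphism_swap)
    have km: "k = m"
      using coef_y_power_ne_0[OF f] True fps2_ord_le_coef[where f = f and i = k and j = 0] f(2)
      by (force simp: m_def x_order_def)
    have "coef f 0 j = 0" if "j < Suc k" for j
      using that True fps2_ord_le_coef[where f = f and i = 0 and j = j]
      by (cases "j = m") (auto simp: km m_def)
    hence "enat (Suc k) \<le> int_num (swap_vars f) Y2"
      by (intro le_int_num_Y2) simp
    also have "Y2 = swap_vars X2"
      by (rule fps2_eqI) auto
    finally have "enat (Suc k) \<le> int_num f X2"
      by (simp add: swap.int_num_eq)
    hence "enat k < int_num f X2"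
      by (simp add: Suc_ile_eq)
    moreover have "smooth X2"
      by (simp add: smooth_def fps2_ord_X2) (simp add: X2_def)
    ultimately show thesis using that by blast
  next
    case False
    obtain c where c: "(\<Sum>l\<le>m. coef f (q * (m - l)) l * c ^ l) = 0"
      using alg_closed[of m "\<lambda>l. coef f (q * (m - l)) l"] m False by auto
    define r where "r = (fps_const (fps_const c * fps_X ^ q) :: 'a fps2)"
    have coef_r: "coef r i j = (if i = q \<and> j = 0 then c else 0)" for i j
      by (auto simp: r_def)
    have "weight_ge 2 1 2 (Y2 + r - Y2)"
      using q by (auto simp: weight_ge_def coef_r split: if_splits)
    then interpret s: fps2_automorphism "subst_y (Y2 + r)"
      by (rule fps2_automorphism_subst_y)
    have w0: "coef (Y2 + r) 0 0 = 0"
      using q by (simp add: coef_r)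
    have "subst_y (Y2 + r) r = r"
      unfolding r_def by (rule subst_y_const)
    hence "subst_y (Y2 + r) (Y2 - r) = Y2"
      by (simp add: s.diff subst_y_Y2[OF w0])
    hence int: "int_num f (Y2 - r) = int_num (subst_y (Y2 + r) f) Y2"
      using s.int_num_eq[of f "Y2 - r"] by simp
    have pow: "((Y2 + r) ^ l) $ 0 = fps_const (c ^ l) * fps_X ^ (q * l)" for l
    proof (induction l)
      case (Suc l)
      have "(Y2 + r) $ 0 = fps_const c * fps_X ^ q"
        by (simp add: r_def Y2_def)
      with Suc show ?case
        by (simp add: power_add mult_ac flip: fps_const_mult)
    qed simp
    have coef_term: "coef (fps_const (f $ l) * (Y2 + r) ^ l) i 0 =
        (if q * l \<le> i then coef f (i - q * l) l * c ^ l else 0)" for l i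
    proof -
      have "coef (fps_const (f $ l) * (Y2 + r) ^ l) i 0 =
          (fps_const (c ^ l) * (fps_X ^ (q * l) * f $ l)) $ i"
        by (simp add: pow mult_ac)
      thus ?thesis
        by (auto simp: fps_X_power_mult_nth)
    qed
    have "coef (subst_y (Y2 + r) f) i 0 = 0" if "i < Suc k" for i
    proof (cases "i = k")
      case False
      with that have "i < k" by simp
      have "coef f (i - q * l) l = 0" if "q * l \<le> i" for l
      proof (rule weight_geD[OF irreducible_newton_polygon[OF f]])
        have "m * (i - q * l) + k * l = m * i"
          using that by (simp add: k right_diff_distrib' mult_ac)
        thus "fps2_ord f * (i - q * l) + k * l < fps2_ord f * k"
          using \<open>i < k\<close> m by (simp add: m_def)
      qed
      thus ?thesis
        unfolding subst_y_def coef_of_coefs add_0_right coef_term by (intro sum.neutral) simp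
    next
      case True
      have "coef (subst_y (Y2 + r) f) i 0 =
          (\<Sum>l\<le>k. if q * l \<le> k then coef f (k - q * l) l * c ^ l else 0)"
        unfolding subst_y_def coef_of_coefs by (simp only: coef_term True add_0_right)
      also have "\<dots> = (\<Sum>l\<le>m. if q * l \<le> k then coef f (k - q * l) l * c ^ l else 0)"
      proof (rule sum.mono_neutral_right)
        show "{..m} \<subseteq> {..k}"
          using q by (simp add: k)
      qed (use q in \<open>auto simp: k mult.commute\<close>)
      also have "\<dots> = (\<Sum>l\<le>m. coef f (q * (m - l)) l * c ^ l)"
        by (intro sum.cong refl) (simp add: k right_diff_distrib' mult.commute)
      finally show ?thesis
        using c by simp
    qed
    hence "enat (Suc k) \<le> int_num f (Y2 - r)"
      unfolding int by (intro le_int_num_Y2) simp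
    hence "enat k < int_num f (Y2 - r)"
      by (simp add: Suc_ile_eq)
    moreover have "smooth (Y2 - r)"
    proof -
      have "coef (Y2 - r) 0 1 = 1" by (simp add: coef_r)
      moreover have "weight_ge 1 1 1 (Y2 - r)"
        using q by (intro weight_ge_nonunit) (simp add: coef_r)
      ultimately have "fps2_ord (Y2 - r) = 1" "Y2 - r \<noteq> 0"
        by (auto intro: fps2_ord_eqI[where i = 0 and j = 1])
      thus ?thesis by (simp add: smooth_def)
    qed
    ultimately show thesis using that by blast
  qed
qed

text \<open>
Statements about the intersection with a smooth branch reduce to the branch \<open>y = 0\<close>.
\<close>

lemma smooth_coordinates:
  assumes "smooth w"
  obtains \<sigma> where "fps2_automorphism \<sigma>" "\<And>f. int_num (\<sigma> f) w = int_num f Y2"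
proof -
  obtain \<sigma> where \<sigma>: "fps2_automorphism \<sigma>" "ideal_gen {w} = ideal_gen {\<sigma> Y2}"
    using smooth_straighten[OF assms] .
  interpret fps2_automorphism \<sigma> by fact
  have "int_num (\<sigma> f) w = int_num f Y2" for f
    using int_num_cong_right[OF \<sigma>(2)] int_num_eq by simp
  with \<sigma>(1) that show thesis by blast
qed

section \<open>The triangle inequality with a smooth vertex\<close>

text \<open>
The comparison of slopes for the axis \<open>y = 0\<close>, including the case that one of the series defines this
axis and has infinite slope.
\<close>

lemma int_num_triangle_y:
  fixes f g :: "'a::field fps2"
  assumes f: "irreducible f" and g: "irreducible g"
    and le: "int_num f Y2 * enat (fps2_ord g) \<le> int_num g Y2 * enat (fps2_ord f)"
  shows "int_num f Y2 * enat (fps2_ord g) \<le> int_num f g"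
    and "int_num f Y2 * enat (fps2_ord g) < int_num g Y2 * enat (fps2_ord f) \<Longrightarrow>
           int_num f g = int_num f Y2 * enat (fps2_ord g)"
proof -
  have pos: "fps2_ord f > 0" "fps2_ord g > 0"
    using f g irreducible_fps2_ord_pos by auto
  have "int_num f Y2 * enat (fps2_ord g) \<le> int_num f g \<and>
    (int_num f Y2 * enat (fps2_ord g) < int_num g Y2 * enat (fps2_ord f) \<longrightarrow>
           int_num f g = int_num f Y2 * enat (fps2_ord g))"
  proof (cases rule: x_order_cases[of g])
    case 1
    have "g \<noteq> 0" using g by auto
    hence "fps2_ord g = 1"
      using fps2_ord_cong[OF _ ideal_gen_eq_Y2[OF g 1]] by (simp add: fps2_ord_Y2)
    moreover have "int_num f g = int_num f Y2"
      by (rule int_num_cong_right[OF ideal_gen_eq_Y2[OF g 1]])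
    ultimately show ?thesis
      by (simp add: one_enat_def[symmetric] del: One_nat_def)
  next
    case g': (2 l)
    show ?thesis
    proof (cases rule: x_order_cases[of f])
      case 1
      with le pos show ?thesis
        by (simp add: int_num_Y2_infinity int_num_Y2[OF g'] imult_is_infinity zero_enat_def)
    next
      case f': (2 k)
      show ?thesis
        using le int_num_ge_min[OF f f' g g'] int_num_eq_min[OF f f' g g']
        by (simp add: int_num_Y2[OF f'] int_num_Y2[OF g'])
    qed
  qed
  thus "int_num f Y2 * enat (fps2_ord g) \<le> int_num f g"
    and "int_num f Y2 * enat (fps2_ord g) < int_num g Y2 * enat (fps2_ord f) \<Longrightarrow>
           int_num f g = int_num f Y2 * enat (fps2_ord g)"
    by blast+
qed

lemma int_num_triangle:
  fixes f g w :: "'a::field fps2"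
  assumes f: "irreducible f" and g: "irreducible g" and w: "smooth w"
    and le: "int_num f w * enat (fps2_ord g) \<le> int_num g w * enat (fps2_ord f)"
  shows "int_num f w * enat (fps2_ord g) \<le> int_num f g"
    and "int_num f w * enat (fps2_ord g) < int_num g w * enat (fps2_ord f) \<Longrightarrow>
           int_num f g = int_num f w * enat (fps2_ord g)"
proof -
  obtain \<sigma> where \<sigma>: "fps2_automorphism \<sigma>" and w': "\<And>f. int_num (\<sigma> f) w = int_num f Y2"
    using smooth_coordinates[OF w] by blast
  interpret fps2_automorphism \<sigma> by fact
  obtain f' g' where fg: "f = \<sigma> f'" "g = \<sigma> g'"
    by (metis surj_obtain)
  hence irr: "irreducible f'" "irreducible g'"
    using f g by (simp_all add: irreducible_iff)
  hence ord: "fps2_ord f = fps2_ord f'" "fps2_ord g = fps2_ord g'"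
    by (simp_all add: fg fps2_ord_eq)
  show "int_num f w * enat (fps2_ord g) \<le> int_num f g"
    and "int_num f w * enat (fps2_ord g) < int_num g w * enat (fps2_ord f) \<Longrightarrow>
           int_num f g = int_num f w * enat (fps2_ord g)"
    using int_num_triangle_y[OF irr] le unfolding ord unfolding fg w' int_num_eq by blast+
qed

lemma ratio_le_iff:
  assumes "m > 0" "n > 0"
  shows "ereal_of_enat K / ereal (real m) \<le> ereal_of_enat L / ereal (real n) \<longleftrightarrow>
         K * enat n \<le> L * enat m"
proof (cases K; cases L)
  fix k l assume "K = enat k" "L = enat l"
  moreover have "real k / real m \<le> real l / real n \<longleftrightarrow> k * n \<le> l * m"
    using assms by (simp add: divide_le_eq le_divide_eq flip: of_nat_mult)
  ultimately show ?thesis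
    using assms by simp
qed (use assms in \<open>simp_all add: imult_is_infinity zero_enat_def\<close>)

text \<open>
The order of contact of two branches in terms of their equations.
\<close>

definition contact_ratio :: "'a::field fps2 \<Rightarrow> 'a fps2 \<Rightarrow> ereal" where
  "contact_ratio f g = ereal_of_enat (int_num f g) / ereal (real (fps2_ord f * fps2_ord g))"

lemma contact_ratio_commute: "contact_ratio f g = contact_ratio g f"
  by (simp add: contact_ratio_def int_num_commute mult.commute)

lemma contact_ratio_smooth:
  "smooth w \<Longrightarrow> contact_ratio f w = ereal_of_enat (int_num f w) / ereal (real (fps2_ord f))"
  by (simp add: contact_ratio_def smooth_def)

text \<open>
Among the contacts of two branches with each other and with a smooth branch, the two smaller ones agree.
\<close>

lemma contact_ratio_isosceles:
  fixes f g w :: "'a::field fps2"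
  assumes f: "irreducible f" and g: "irreducible g" and w: "smooth w"
    and le: "contact_ratio f w \<le> contact_ratio g w"
  shows "contact_ratio f w \<le> contact_ratio f g"
    and "contact_ratio f w < contact_ratio g w \<Longrightarrow> contact_ratio f g = contact_ratio f w"
proof -
  define m n where "m = fps2_ord f" and "n = fps2_ord g"
  have pos: "m > 0" "n > 0" "m * n > 0"
    using f g irreducible_fps2_ord_pos by (auto simp: m_def n_def)
  have ratio: "contact_ratio f w = ereal_of_enat (int_num f w) / ereal (real m)"
    "contact_ratio g w = ereal_of_enat (int_num g w) / ereal (real n)"
    "contact_ratio f g = ereal_of_enat (int_num f g) / ereal (real (m * n))"
    by (simp_all only: contact_ratio_smooth[OF w] m_def n_def contact_ratio_def[of f g])
  have iff: "contact_ratio f w \<le> contact_ratio g w \<longleftrightarrow> int_num f w * enat n \<le> int_num g w * enat m"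
    "contact_ratio g w \<le> contact_ratio f w \<longleftrightarrow> int_num g w * enat m \<le> int_num f w * enat n"
    unfolding ratio by (rule ratio_le_iff; fact)+
  have split: "int_num f w * enat (m * n) = int_num f w * enat n * enat m"
    by (simp add: mult_ac flip: times_enat_simps(1))
  have "int_num f w * enat n \<le> int_num f g"
    using int_num_triangle(1)[OF f g w] le iff(1) by (simp add: m_def n_def)
  hence "int_num f w * enat (m * n) \<le> int_num f g * enat m"
    unfolding split by (intro mult_right_mono) simp_all
  thus ge: "contact_ratio f w \<le> contact_ratio f g"
    unfolding ratio using pos by (subst ratio_le_iff) simp_all
  assume "contact_ratio f w < contact_ratio g w"
  hence "int_num f w * enat n < int_num g w * enat m"
    using iff(2) by (simp add: not_le[symmetric])
  hence "int_num f g = int_num f w * enat n"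
    using int_num_triangle(2)[OF f g w] by (simp add: m_def n_def)
  hence "int_num f g * enat m \<le> int_num f w * enat (m * n)"
    unfolding split by simp
  hence "contact_ratio f g \<le> contact_ratio f w"
    unfolding ratio using pos by (subst ratio_le_iff) simp_all
  with ge show "contact_ratio f g = contact_ratio f w"
    by simp
qed

lemma contact_ratio_triangle:
  fixes f g w :: "'a::field fps2"
  assumes f: "irreducible f" and g: "irreducible g" and w: "smooth w"
  shows "min (contact_ratio f w) (contact_ratio g w) \<le> contact_ratio f g"
    and "min (contact_ratio f g) (contact_ratio f w) \<le> contact_ratio g w"
  using contact_ratio_isosceles[OF f g w] contact_ratio_isosceles[OF g f w]
  by (cases "contact_ratio f w" "contact_ratio g w" rule: linorder_cases;
      simp add: contact_ratio_commute[of g f] min_le_iff_disj)+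

section \<open>The semigroup determines the contact with smooth branches\<close>

text \<open>
The semigroup of a branch in terms of one fixed equation.
\<close>

definition semigroup_of :: "'a::field fps2 \<Rightarrow> enat set" where
  "semigroup_of f = {int_num f g | g. \<not> f dvd g}"

lemma int_num_smooth_le:
  fixes f w :: "'a::field fps2"
  assumes f: "irreducible f" and w: "smooth w"
    and v: "int_num f g = enat v" "\<not> fps2_ord f dvd v"
  shows "int_num f w \<le> enat v"
proof -
  obtain \<sigma> where \<sigma>: "fps2_automorphism \<sigma>" and w': "\<And>f. int_num (\<sigma> f) w = int_num f Y2"
    using smooth_coordinates[OF w] by blast
  interpret fps2_automorphism \<sigma> by fact
  obtain f' g' where fg: "f = \<sigma> f'" "g = \<sigma> g'"
    by (metis surj_obtain)
  have irr: "irreducible f'"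
    using f by (simp add: fg irreducible_iff)
  hence v': "int_num f' g' = enat v" "\<not> fps2_ord f' dvd v"
    using v by (simp_all add: fg int_num_eq fps2_ord_eq)
  show ?thesis
  proof (cases rule: x_order_cases[of f'])
    case 1
    have "f' \<noteq> 0" using irr by auto
    hence "fps2_ord f' = 1"
      using fps2_ord_cong[OF _ ideal_gen_eq_Y2[OF irr 1]] by (simp add: fps2_ord_Y2)
    with v' show ?thesis by simp
  next
    case (2 k)
    with x_order_le_if_not_dvd[OF irr 2 v'] show ?thesis
      by (simp add: fg w' int_num_Y2)
  qed
qed

lemma smooth_increase_contact:
  fixes f w :: "'a::alg_closed_field fps2"
  assumes f: "irreducible f" and w: "smooth w"
    and v: "int_num f w = enat v" "fps2_ord f dvd v"
  obtains w' where "smooth w'" "enat v < int_num f w'"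
proof -
  obtain \<sigma> where \<sigma>: "fps2_automorphism \<sigma>" and w': "\<And>f. int_num (\<sigma> f) w = int_num f Y2"
    using smooth_coordinates[OF w] by blast
  interpret fps2_automorphism \<sigma> by fact
  obtain f' where fg: "f = \<sigma> f'"
    by (metis surj_obtain)
  have irr: "irreducible f'"
    using f by (simp add: fg irreducible_iff)
  have v': "int_num f' Y2 = enat v" "fps2_ord f' dvd v"
    using v irr by (simp_all add: fg w' fps2_ord_eq)
  then obtain k where k: "x_order f' k"
    using int_num_Y2_infinity by (metis enat.distinct(2) x_order_cases)
  with v' have "k = v"
    by (simp add: int_num_Y2)
  with k v' obtain u where "smooth u" "enat v < int_num f' u"
    using smooth_increase_contact_y[OF irr, of v] by blast
  with that[of "\<sigma> u"] show thesis
    by (simp add: smooth fg int_num_eq)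
qed

lemma fps2_ord_eq_1_if_infinite:
  assumes f: "irreducible f" and w: "smooth w" and "int_num f w = \<infinity>"
  shows "fps2_ord f = 1"
proof -
  obtain \<sigma> where \<sigma>: "fps2_automorphism \<sigma>" and w': "\<And>f. int_num (\<sigma> f) w = int_num f Y2"
    using smooth_coordinates[OF w] by blast
  interpret fps2_automorphism \<sigma> by fact
  obtain f' where fg: "f = \<sigma> f'"
    by (metis surj_obtain)
  have irr: "irreducible f'"
    using f by (simp add: fg irreducible_iff)
  hence "f' \<noteq> 0" by auto
  have "int_num f' Y2 = \<infinity>"
    using assms by (simp add: fg w')
  hence "\<forall>i. coef f' i 0 = 0"
    by (cases rule: x_order_cases[of f']) (auto simp: int_num_Y2)
  from fps2_ord_cong[OF \<open>f' \<noteq> 0\<close> ideal_gen_eq_Y2[OF irr this]] show ?thesis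
    by (simp add: fg fps2_ord_eq[OF irr] fps2_ord_Y2)
qed

lemma not_dvd_if_int_num_finite:
  fixes f g :: "'a::field fps2"
  assumes "irreducible f" "int_num f g = enat v"
  shows "\<not> f dvd g"
proof -
  have "f \<noteq> 0" using assms(1) by auto
  with int_num_eq_infinity_if_dvd[OF _ coef_0_0_irreducible[OF assms(1)], of g] assms(2)
  show ?thesis by auto
qed

text \<open>
The multiplicity is the least nonzero element of the semigroup.
\<close>

lemma fps2_ord_le_if_semigroup_eq:
  fixes f f' :: "'a::field fps2"
  assumes f: "irreducible f" and f': "irreducible f'" and eq: "semigroup_of f = semigroup_of f'"
  shows "fps2_ord f \<le> fps2_ord f'"
proof -
  obtain g where g: "coef g 0 0 = 0" "int_num f' g = enat (fps2_ord f')"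
    using fps2_ord_eq_int_num[OF f'] .
  hence "enat (fps2_ord f') \<in> semigroup_of f'"
    using not_dvd_if_int_num_finite[OF f' g(2)] unfolding semigroup_of_def by force
  then obtain h where h: "int_num f h = enat (fps2_ord f')"
    unfolding eq[symmetric] by (auto simp: semigroup_of_def)
  have "coef h 0 0 = 0"
  proof (rule ccontr)
    assume "coef h 0 0 \<noteq> 0"
    hence "int_num f h = 0"
      by (intro quotient_dim_unit) (simp add: unit_iff)
    with h irreducible_fps2_ord_pos[OF f'] show False
      by (simp add: zero_enat_def)
  qed
  moreover have "f \<noteq> 0" using f by auto
  ultimately show ?thesis
    using fps2_ord_le_int_num[of f h] by (simp add: h)
qed

text \<open>
Otherwise the contacts of \<open>f'\<close> with smooth branches are bounded by \<open>(f, w)\<close>. If they are bounded by a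
number, the largest one \<open>v\<close> is not divisible by the multiplicity, since it could be increased. It is an
element of the common semigroup, and therefore \<open>(f, w) \<le> v\<close>, a contradiction. If \<open>(f, w) = \<infinity>\<close>, both
branches are smooth, and \<open>f'\<close> has infinite contact with itself.
\<close>

lemma smooth_contact_le_if_semigroup_eq:
  fixes f f' w :: "'a::alg_closed_field fps2"
  assumes f: "irreducible f" and f': "irreducible f'" and w: "smooth w"
    and eq: "semigroup_of f = semigroup_of f'"
  shows "\<exists>w'. smooth w' \<and> int_num f w \<le> int_num f' w'"
proof (rule ccontr)
  assume "\<not> ?thesis"
  hence less: "int_num f' w' < int_num f w" if "smooth w'" for w'
    using that by (meson not_le)
  have ord: "fps2_ord f = fps2_ord f'"
    using fps2_ord_le_if_semigroup_eq[OF f f' eq] fps2_ord_le_if_semigroup_eq[OF f' f eq[symmetric]]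
    by simp
  show False
  proof (cases "int_num f w")
    case infinity
    hence "fps2_ord f' = 1"
      using fps2_ord_eq_1_if_infinite[OF f w] ord by simp
    hence "smooth f'"
      using f' by (auto simp: smooth_def)
    from less[OF this] show False
      using not_dvd_if_int_num_finite[OF f', of f'] by (cases "int_num f' f'") auto
  next
    case (enat k)
    let ?P = "\<lambda>v. \<exists>w'. smooth w' \<and> int_num f' w' = enat v"
    have P: "v < k" if v: "?P v" for v
    proof -
      obtain w' where "smooth w'" "int_num f' w' = enat v"
        using v by blast
      with less[of w'] enat show ?thesis by simp
    qed
    obtain v0 where "?P v0"
      using less[OF smooth_Y2] smooth_Y2 by (cases "int_num f' Y2") auto
    then obtain v where v: "?P v" and max: "\<forall>u. ?P u \<longrightarrow> u \<le> v"
      using ex_has_greatest_nat[of ?P v0 "\<lambda>v. v" k] P by auto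
    obtain w' where w': "smooth w'" "int_num f' w' = enat v"
      using v by blast
    have ndvd: "\<not> fps2_ord f' dvd v"
    proof
      assume "fps2_ord f' dvd v"
      then obtain u where u: "smooth u" "enat v < int_num f' u"
        using smooth_increase_contact[OF f' w'] by blast
      with less[OF u(1)] obtain v' where "int_num f' u = enat v'"
        by (cases "int_num f' u") auto
      with u max show False by force
    qed
    have "enat v \<in> semigroup_of f'"
      using w'(2) not_dvd_if_int_num_finite[OF f' w'(2)] unfolding semigroup_of_def by force
    then obtain g where "int_num f g = enat v"
      unfolding eq[symmetric] by (auto simp: semigroup_of_def)
    with ndvd have "int_num f w \<le> enat v"
      by (intro int_num_smooth_le[OF f w]) (simp_all add: ord)
    with P[OF v] show False
      by (simp add: enat)
  qed
qed

section \<open>The contact exponent of a curve\<close>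

lemma branch_contact_ideal_gen:
  assumes "irreducible f" "irreducible g"
  shows "branch_contact (ideal_gen {f}) (ideal_gen {g}) = contact_ratio f g"
proof -
  have "f \<noteq> 0" "g \<noteq> 0" using assms by auto
  thus ?thesis
    by (simp add: branch_contact_def contact_ratio_def multiplicity_ideal_gen
                  intersection_number_ideal_gen)
qed

lemma smooth_branch_iff: "smooth_branch W \<longleftrightarrow> (\<exists>w. smooth w \<and> W = ideal_gen {w})"
proof
  assume W: "smooth_branch W"
  then obtain w where w: "W = ideal_gen {w}" "irreducible w"
    by (auto simp: smooth_branch_def branch_def)
  moreover have "w \<noteq> 0" using w(2) by auto
  hence "smooth w"
    using W w(1) by (simp add: smooth_branch_def smooth_def multiplicity_ideal_gen)
  ultimately show "\<exists>w. smooth w \<and> W = ideal_gen {w}"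
    by blast
next
  assume "\<exists>w. smooth w \<and> W = ideal_gen {w}"
  then obtain w where w: "smooth w" "W = ideal_gen {w}" by blast
  hence "irreducible w" by (simp add: irreducible_smooth)
  moreover have "multiplicity W = 1"
    using w by (simp add: smooth_def multiplicity_ideal_gen)
  moreover have "w \<noteq> 0" "coef w 0 0 = 0"
    using w(1) coef_0_0_irreducible[OF \<open>irreducible w\<close>] by (auto simp: smooth_def)
  ultimately show "smooth_branch W"
    unfolding smooth_branch_def branch_def algebroid_curve_def w(2) by blast
qed

lemma branches_irreducible:
  fixes w :: "'a::field fps2"
  assumes w: "irreducible w"
  shows "branches (ideal_gen {w}) = {ideal_gen {w}}"
proof (intro set_eqI iffI)
  fix B assume "B \<in> branches (ideal_gen {w})"
  then obtain f p where p: "ideal_gen {w} = ideal_gen {f}" "irreducible p" "p dvd f" "B = ideal_gen {p}"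
    by (auto simp: branches_def)
  hence "f dvd w" by (simp add: ideal_gen_singleton_eq_iff)
  with p(3) have "p dvd w" by (rule dvd_trans)
  then obtain h where h: "w = p * h" by (elim dvdE)
  have "\<not> p dvd 1" using p(2) by (rule irreducible_not_unit)
  with irreducibleD[OF w h] obtain k where "1 = h * k" by (auto elim: dvdE)
  hence "p = w * k" by (simp add: h mult.assoc)
  hence "w dvd p" by (rule dvdI)
  with \<open>p dvd w\<close> have "ideal_gen {p} = ideal_gen {w}"
    by (simp add: ideal_gen_singleton_eq_iff)
  thus "B \<in> {ideal_gen {w}}" by (simp add: p(4))
next
  fix B assume "B \<in> {ideal_gen {w}}"
  with w show "B \<in> branches (ideal_gen {w})"
    unfolding branches_def using dvd_refl by blast
qed

lemma branchesE:
  assumes "B \<in> branches C"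
  obtains p where "irreducible p" "B = ideal_gen {p}"
  using assms by (auto simp: branches_def)

lemma branch_semigroup_ideal_gen: "branch_semigroup (ideal_gen {f}) = semigroup_of f"
proof -
  have "int_num f' g \<in> semigroup_of f" if "ideal_gen {f} = ideal_gen {f'}" "\<not> f' dvd g" for f' g
  proof -
    have "\<not> f dvd g"
      using that dvd_trans unfolding ideal_gen_singleton_eq_iff by blast
    thus ?thesis
      unfolding semigroup_of_def int_num_cong_left[OF that(1), of g, symmetric] by blast
  qed
  thus ?thesis
    by (auto simp: branch_semigroup_def semigroup_of_def)
qed

lemma contact_smooth:
  assumes "smooth w"
  shows "contact C (ideal_gen {w}) = (INF B\<in>branches C. branch_contact B (ideal_gen {w}))"
proof -
  have "branches C \<times> branches (ideal_gen {w}) = (\<lambda>B. (B, ideal_gen {w})) ` branches C"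
    unfolding branches_irreducible[OF irreducible_smooth[OF assms]] by auto
  thus ?thesis
    by (simp add: contact_def image_image)
qed

lemma contact_exponent_smooth:
  "contact_exponent C = (SUP w\<in>{w. smooth w}. INF B\<in>branches C. branch_contact B (ideal_gen {w}))"
proof -
  have "{W. smooth_branch W} = (\<lambda>w. ideal_gen {w}) ` {w :: 'a fps2. smooth w}"
    by (auto simp: smooth_branch_iff)
  thus ?thesis
    by (simp add: contact_exponent_def image_image contact_smooth)
qed

text \<open>
Any branch can serve as the reference branch \<open>f\<close>. By the triangle inequality, a smooth branch that is
close to all branches of \<open>C\<close> forces them to be close to each other, which bounds the contact exponent
from above; conversely, a smooth branch that is close to \<open>f\<close> is also close to every branch that is close
to \<open>f\<close>.
\<close>

lemma contact_exponent_eq_min: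
  fixes C :: "'a::field fps2 set"
  assumes C: "ideal_gen {f} \<in> branches C" and f: "irreducible f"
  shows "contact_exponent C = min (SUP w\<in>{w. smooth w}. contact_ratio f w)
                                  (INF B\<in>branches C. branch_contact (ideal_gen {f}) B)"
    (is "_ = min ?S ?I")
proof (rule antisym)
  show "contact_exponent C \<le> min ?S ?I"
    unfolding contact_exponent_smooth
  proof (rule SUP_least)
    fix w :: "'a fps2" assume "w \<in> {w. smooth w}"
    hence w: "smooth w" "irreducible w"
      by (simp_all add: irreducible_smooth)
    let ?d = "INF B\<in>branches C. branch_contact B (ideal_gen {w})"
    have le_f: "?d \<le> contact_ratio f w"
      using INF_lower[OF C, of "\<lambda>B. branch_contact B (ideal_gen {w})"]
      by (simp add: branch_contact_ideal_gen f w)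
    have "contact_ratio f w \<le> ?S"
      by (rule SUP_upper) (simp add: w)
    with le_f have "?d \<le> ?S"
      by (rule order.trans)
    moreover have "?d \<le> ?I"
    proof (rule INF_greatest)
      fix B assume B: "B \<in> branches C"
      then obtain p where p: "irreducible p" "B = ideal_gen {p}"
        by (rule branchesE)
      have "?d \<le> contact_ratio p w"
        using INF_lower[OF B, of "\<lambda>B. branch_contact B (ideal_gen {w})"]
        by (simp add: branch_contact_ideal_gen p w)
      with le_f have "?d \<le> min (contact_ratio f w) (contact_ratio p w)"
        by simp
      also have "\<dots> \<le> contact_ratio f p"
        by (rule contact_ratio_triangle(1)[OF f p(1) w(1)])
      finally show "?d \<le> branch_contact (ideal_gen {f}) B"
        by (simp add: p(2) branch_contact_ideal_gen f p(1))
    qed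
    ultimately show "?d \<le> min ?S ?I" by simp
  qed
next
  show "min ?S ?I \<le> contact_exponent C"
  proof (rule ccontr)
    assume "\<not> ?thesis"
    hence "contact_exponent C < ?S" and I: "contact_exponent C < ?I"
      by (simp_all add: not_le)
    then obtain w where w: "smooth w" "contact_exponent C < contact_ratio f w"
      by (auto simp: less_SUP_iff)
    have "min ?I (contact_ratio f w) \<le> (INF B\<in>branches C. branch_contact B (ideal_gen {w}))"
    proof (rule INF_greatest)
      fix B assume B: "B \<in> branches C"
      then obtain p where p: "irreducible p" "B = ideal_gen {p}"
        by (rule branchesE)
      have "?I \<le> contact_ratio f p"
        using INF_lower[OF B, of "\<lambda>B. branch_contact (ideal_gen {f}) B"]
        by (simp add: branch_contact_ideal_gen p f)
      hence "min ?I (contact_ratio f w) \<le> min (contact_ratio f p) (contact_ratio f w)"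
        by (rule min.mono) simp
      also have "\<dots> \<le> contact_ratio p w"
        by (rule contact_ratio_triangle(2)[OF f p(1) w(1)])
      finally show "min ?I (contact_ratio f w) \<le> branch_contact B (ideal_gen {w})"
        by (simp add: p branch_contact_ideal_gen irreducible_smooth[OF w(1)])
    qed
    also have "\<dots> \<le> contact_exponent C"
      unfolding contact_exponent_smooth by (rule SUP_upper) (simp add: w)
    finally show False
      using w(2) I by (auto simp: min_le_iff_disj)
  qed
qed

lemma smooth_SUP_le_if_semigroup_eq:
  fixes f f' :: "'a::alg_closed_field fps2"
  assumes f: "irreducible f" and f': "irreducible f'" and eq: "semigroup_of f = semigroup_of f'"
  shows "(SUP w\<in>{w. smooth w}. contact_ratio f w) \<le> (SUP w\<in>{w. smooth w}. contact_ratio f' w)"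
proof (rule SUP_mono)
  fix w :: "'a fps2" assume "w \<in> {w. smooth w}"
  then obtain w' where w: "smooth w" "smooth w'" "int_num f w \<le> int_num f' w'"
    using smooth_contact_le_if_semigroup_eq[OF f f' _ eq] by auto
  have "fps2_ord f = fps2_ord f'"
    using fps2_ord_le_if_semigroup_eq[OF f f' eq] fps2_ord_le_if_semigroup_eq[OF f' f eq[symmetric]]
    by simp
  hence "contact_ratio f w \<le> contact_ratio f' w'"
    using w irreducible_fps2_ord_pos[OF f']
    by (simp add: contact_ratio_smooth ratio_le_iff mult_right_mono)
  with w(2) show "\<exists>w'\<in>{w. smooth w}. contact_ratio f w \<le> contact_ratio f' w'"
    by blast
qed

text \<open>
In the formula of \<open>contact_exponent_eq_min\<close> for corresponding branches of the two curves, the suprema agree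
because the semigroups do, and the infima agree term by term because the multiplicities and the
intersection numbers do.
\<close>

theorem corollary3p4:
  shows "equisingularity_invariant
           (contact_exponent :: 'a::alg_closed_field fps fps set \<Rightarrow> ereal)"
  unfolding equisingularity_invariant_def
proof (intro allI impI)
  fix C D :: "'a fps fps set"
  assume "equisingular C D"
  then obtain r :: nat and Cs Ds where
    bij: "bij_betw Cs {1..r} (branches C)" "bij_betw Ds {1..r} (branches D)" and
    sg: "\<And>i. i \<in> {1..r} \<Longrightarrow> branch_semigroup (Cs i) = branch_semigroup (Ds i)" and
    int: "\<And>i j. i \<in> {1..r} \<Longrightarrow> j \<in> {1..r} \<Longrightarrow>
            intersection_number (Cs i) (Cs j) = intersection_number (Ds i) (Ds j)"
    unfolding equisingular_def by blast
  have img: "branches C = Cs ` {1..r}" "branches D = Ds ` {1..r}"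
    using bij by (simp_all add: bij_betw_def)
  have gens: "\<exists>f g. irreducible f \<and> irreducible g \<and> Cs i = ideal_gen {f} \<and> Ds i = ideal_gen {g} \<and>
      semigroup_of f = semigroup_of g \<and> fps2_ord f = fps2_ord g" if i: "i \<in> {1..r}" for i
  proof -
    have "Cs i \<in> branches C" "Ds i \<in> branches D"
      using i img by auto
    then obtain f g where fg: "irreducible f" "irreducible g" "Cs i = ideal_gen {f}" "Ds i = ideal_gen {g}"
      by (metis branchesE)
    hence eq: "semigroup_of f = semigroup_of g"
      using sg[OF i] by (simp add: branch_semigroup_ideal_gen)
    with fg show ?thesis
      using fps2_ord_le_if_semigroup_eq[of f g] fps2_ord_le_if_semigroup_eq[of g f] by force
  qed
  show "contact_exponent C = contact_exponent D"
  proof (cases "r = 0")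
    \<comment> \<open>without branches both infima are the top element\<close>
    case True
    thus ?thesis
      by (simp add: contact_exponent_smooth img)
  next
    case False
    hence one: "1 \<in> {1..r}" by simp
    then obtain f g where fg: "irreducible f" "irreducible g" "Cs 1 = ideal_gen {f}" "Ds 1 = ideal_gen {g}"
      "semigroup_of f = semigroup_of g"
      using gens by blast
    have "branch_contact (Cs 1) (Cs i) = branch_contact (Ds 1) (Ds i)" if i: "i \<in> {1..r}" for i
    proof -
      have "multiplicity (Cs j) = multiplicity (Ds j)" if "j \<in> {1..r}" for j
        using gens[OF that] by (metis irreducible_def multiplicity_ideal_gen)
      with i one int show ?thesis
        by (simp add: branch_contact_def)
    qed
    hence "(INF B\<in>branches C. branch_contact (Cs 1) B) = (INF B\<in>branches D. branch_contact (Ds 1) B)"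
      by (simp add: img image_image)
    moreover have "(SUP w\<in>{w. smooth w}. contact_ratio f w) = (SUP w\<in>{w. smooth w}. contact_ratio g w)"
      using smooth_SUP_le_if_semigroup_eq fg by (metis antisym)
    moreover have "Cs 1 \<in> branches C" "Ds 1 \<in> branches D"
      using one img by auto
    ultimately show ?thesis
      using contact_exponent_eq_min[of f C] contact_exponent_eq_min[of g D] fg by simp
  qed
qed

end
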